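(* Let $m\ge1$, and let $p^{\mathscr D}$ be a doubly $m$-closed even Dodgson circle pattern with respect to a circle $\mathscr D\subset\mathbb C$. Assume that Miquel dynamics $T$ can be applied to $p^{\mathscr D}$ at least $m-1$ times. Then there is a circle $\mathscr D'$ such that, when $m$ is even (resp. odd), $T^{m-1}(p^{\mathscr D})$ is an even (resp. odd) Dodgson circle pattern with respect to $\mathscr D'$.
   Context: A circle means a Euclidean circle or line in $\hat{\mathbb C}=\mathbb C\cup\{\infty\}$. A (square grid) circle pattern consists of points $p:\mathbb Z^2\to\hat{\mathbb C}$ and circles $c_{i,j}$ with $p_{i,j},p_{i+1,j},p_{i+1,j+1},p_{i,j+1}\in c_{i,j}$ for all $(i,j)\in\mathbb Z^2$; both points and circles are part of the data. The parity of $c_{i,j}$ is the parity of $i+j$. The pattern is doubly $m$-closed if $c_{i+m,j+m}=c_{i,j}=c_{i+m,j-m}$ for all $(i,j)$. Dodgson circle patterns. Let $\mathscr D$ be a circle and $p^0:\mathbb Z\to\mathscr D$. An even Dodgson circle pattern with respect to $\mathscr D$ is a circle pattern with $p^{\mathscr D}_{i,j}=p^0_{i-j}$ if $i+j$ is odd and $p^{\mathscr D}_{i,j}=p^0_{i+j}$ if $i+j$ is even (so all even circles coincide with $\mathscr D$). An odd Dodgson circle pattern is defined in the same way with the two parities exchanged (so all odd circles coincide with $\mathscr D$). Miquel dynamics. Each circle $c_{i,j}$ has four neighbours $c_{i\pm1,j},c_{i,j\pm1}$; cyclically consecutive neighbours intersect in eight points in total, four of which lie on $c_{i,j}$; by Miquel's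 theorem the other four lie on a sixth circle. For $k\ge1$, $T^k(c)$ is $T^{k-1}(c)$ except that, if $k$ is odd (resp. even), every even (resp. odd) circle is replaced by its sixth circle (and accordingly each intersection point is replaced by the other intersection point of the two unchanged circles through it). "Can be applied" means that the steps are well defined; standing assumption: the data are as generic as possible given the initial singularity. *)

theory Defs
  imports "HOL-Analysis.Analysis"
begin

text \<open>The Riemann sphere is \<^typ>\<open>complex option\<close>, with \<^term>\<open>None\<close> as the point at infinity (the same
  encoding as the library's \<^const>\<open>Alexandroff_compactification\<close>).  Circles are nondegenerate
  Euclidean circles, and straight lines together with infinity.\<close>

definition is_circle :: "complex option set \<Rightarrow> bool" where
  "is_circle C \<longleftrightarrow>
     (\<exists>z r. r > 0 \<and> C = Some ` sphere z r) \<or>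
     (\<exists>a b. a \<noteq> 0 \<and> C = insert None (Some ` {z. inner a z = b}))"

record circle_array =
  pt :: "int \<Rightarrow> int \<Rightarrow> complex option"
  circ :: "int \<Rightarrow> int \<Rightarrow> complex option set"

definition circle_pattern :: "circle_array \<Rightarrow> bool" where
  "circle_pattern P \<longleftrightarrow> (\<forall>i j. is_circle (circ P i j) \<and>
     {pt P i j, pt P (i + 1) j, pt P (i + 1) (j + 1), pt P i (j + 1)} \<subseteq> circ P i j)"

definition doubly_closed :: "nat \<Rightarrow> circle_array \<Rightarrow> bool" where
  "doubly_closed m P \<longleftrightarrow> (\<forall>i j. circ P (i + int m) (j + int m) = circ P i j \<and>
     circ P (i + int m) (j - int m) = circ P i j)"

text \<open>The predicate \<open>q\<close> is \<^term>\<open>even\<close> or \<^term>\<open>odd\<close>.  That the circles of parity \<open>q\<close> equal \<open>D\<close> follows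
  from the position of the points only if such a face has three distinct vertices, which fails
  for doubly 1-closed patterns; it is therefore part of the definition.\<close>

definition dodgson_pattern ::
    "(int \<Rightarrow> bool) \<Rightarrow> complex option set \<Rightarrow> circle_array \<Rightarrow> bool" where
  "dodgson_pattern q D P \<longleftrightarrow> is_circle D \<and> circle_pattern P \<and>
     (\<exists>p0 :: int \<Rightarrow> complex option. range p0 \<subseteq> D \<and>
        (\<forall>i j. pt P i j = (if q (i + j) then p0 (i + j) else p0 (i - j)))) \<and>
     (\<forall>i j. q (i + j) \<longrightarrow> circ P i j = D)"

definition even_dodgson :: "complex option set \<Rightarrow> circle_array \<Rightarrow> bool" where
  "even_dodgson = dodgson_pattern even"

definition odd_dodgson :: "complex option set \<Rightarrow> circle_array \<Rightarrow> bool" where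
  "odd_dodgson = dodgson_pattern odd"

text \<open>Genericity of the initial pattern: no coincidence along an edge of the grid, neither of its
  two endpoints nor of the circles of the two faces sharing it.  (In a Dodgson pattern diagonally
  adjacent points and circles do coincide.)\<close>

definition edge_generic :: "circle_array \<Rightarrow> bool" where
  "edge_generic P \<longleftrightarrow> (\<forall>i j.
     pt P i j \<noteq> pt P (i + 1) j \<and> pt P i j \<noteq> pt P i (j + 1) \<and>
     circ P i j \<noteq> circ P (i + 1) j \<and> circ P i j \<noteq> circ P i (j + 1))"

definition replaced :: "nat \<Rightarrow> int \<Rightarrow> int \<Rightarrow> bool" where
  "replaced k i j \<longleftrightarrow> (if odd k then even (i + j) else odd (i + j))"

text \<open>The vertex \<open>(i, j)\<close> lies on the faces \<open>(i, j)\<close>, \<open>(i - 1, j)\<close>, \<open>(i - 1, j - 1)\<close>, \<open>(i, j - 1)\<close>.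
  \<open>kept_meet k P i j\<close> is the intersection of the two of their circles that step \<open>k\<close> does not
  replace.  For a replaced face, its values at the four corners are the intersections of the
  cyclically consecutive neighbours of the circle.\<close>

definition kept_meet :: "nat \<Rightarrow> circle_array \<Rightarrow> int \<Rightarrow> int \<Rightarrow> complex option set" where
  "kept_meet k P i j =
     (if replaced k i j then circ P (i - 1) j \<inter> circ P i (j - 1)
      else circ P i j \<inter> circ P (i - 1) (j - 1))"

definition other_point :: "nat \<Rightarrow> circle_array \<Rightarrow> int \<Rightarrow> int \<Rightarrow> complex option" where
  "other_point k P i j = (THE y. y \<noteq> pt P i j \<and> kept_meet k P i j = {pt P i j, y})"

definition sixth_circle :: "nat \<Rightarrow> circle_array \<Rightarrow> int \<Rightarrow> int \<Rightarrow> complex option set" where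
  "sixth_circle k P i j = (THE C. is_circle C \<and>
     {other_point k P i j, other_point k P (i + 1) j,
      other_point k P (i + 1) (j + 1), other_point k P i (j + 1)} \<subseteq> C)"

definition miquel_step :: "nat \<Rightarrow> circle_array \<Rightarrow> circle_array" where
  "miquel_step k P =
     \<lparr>pt = other_point k P,
      circ = (\<lambda>i j. if replaced k i j then sixth_circle k P i j else circ P i j)\<rparr>"

fun miquel_iter :: "nat \<Rightarrow> circle_array \<Rightarrow> circle_array" where
  "miquel_iter 0 P = P"
| "miquel_iter (Suc k) P = miquel_step (Suc k) (miquel_iter k P)"

text \<open>Step \<open>k\<close> is defined if, at every replaced circle, the cyclically consecutive neighbours
  intersect in eight points in total.  Distinct circles meet in at most two points and coinciding
  ones in infinitely many, so this says that every such pair meets in exactly two points and that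
  these eight points are pairwise distinct.  The existence of the sixth circle is not assumed: it
  is Miquel's theorem.\<close>

definition step_defined :: "nat \<Rightarrow> circle_array \<Rightarrow> bool" where
  "step_defined k P \<longleftrightarrow> (\<forall>i j. replaced k i j \<longrightarrow>
     card (kept_meet k P i j \<union> kept_meet k P (i + 1) j \<union>
           kept_meet k P (i + 1) (j + 1) \<union> kept_meet k P i (j + 1)) = 8)"

definition miquel_applicable :: "nat \<Rightarrow> circle_array \<Rightarrow> bool" where
  "miquel_applicable n P \<longleftrightarrow> (\<forall>k<n. step_defined (Suc k) (miquel_iter k P))"

end

(*
  Put a_u = p0 u.  An odd circle c(i,j) passes through a_u and a_v, where u = i - j is odd and
  v = i + j + 1 is even, so with q the equation of D it has an equation
  K_uv q(z) = (z - a_u) cnj(z - a_v).  Miquel dynamics is then a condensation of the matrix K: after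
  k steps the circles are the zero sets of the minors of K of order k + 1 and k (contiguous rows and
  columns) bordered by z - a_u, cnj(z - a_v) and q(z), and the points are the z at which a
  bordered window with one row more (or less) than columns has dependent columns (rows).
  By Leibniz such a determinant is a complex combination of |z|^2, z, cnj z and 1, whose zero set
  is a circle as soon as it contains three points and is not everything.  A point on two
  neighbouring loci of the same order makes either their common window or their union degenerate;
  these are the old and the new intersection point.
  Double m-closedness makes K periodic with period m in both directions, so all windows of order m
  contain the same rows and columns up to a cyclic permutation, and the last locus is constant.
*)
theory Submission
  imports Defs "Jordan_Normal_Form.Determinant"
begin

section \<open>Circles and sesquilinear forms\<close>

text \<open>Only the vanishing of minors matters, so dependence of rows or columns replaces
  determinant identities; signs and the order of rows then disappear. The entries of K are complex,
  hence the forms are not Hermitian, and no minor is assumed to be nonzero: nondegeneracy has to be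
  drawn from the eight-point condition. If a new locus were the whole sphere, condensation would put
  a circle of the current pattern into the union of its intersections with two neighbours, which is
  finite. If an old intersection point lay on the new locus, that circle would share three points
  with each of two neighbours and equal both. So each point of the pattern is the only solution of
  its degeneracy condition. This tells the old from the new point in the next step, and it settles
  the points at the end: a tall window with m rows uses all rows up to period, so its point depends
  on i + j alone; a wide one with m columns gives a point depending on i - j alone. This is the
  Dodgson position rule, its parity shifted by m - 1. Closedness speaks only of circles; the
  periodicity of a_u is derived from the points in which c(i,j) meets D.\<close>

definition sesq :: "complex \<Rightarrow> complex \<Rightarrow> complex \<Rightarrow> complex \<Rightarrow> complex option \<Rightarrow> complex" where
  "sesq \<alpha> \<beta> \<gamma> \<delta> p =
     (case p of None \<Rightarrow> \<alpha> | Some z \<Rightarrow> \<alpha> * (z * cnj z) + \<beta> * z + \<gamma> * cnj z + \<delta>)"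

lemma sesq_simps [simp]:
  "sesq \<alpha> \<beta> \<gamma> \<delta> None = \<alpha>"
  "sesq \<alpha> \<beta> \<gamma> \<delta> (Some z) = \<alpha> * (z * cnj z) + \<beta> * z + \<gamma> * cnj z + \<delta>"
  by (simp_all add: sesq_def)

text \<open>The coefficients are arbitrary complex numbers, so that the set is closed under complex
  linear combinations such as Leibniz expansions. The value at infinity is the coefficient of |z|^2:
  infinity is a zero exactly when the form has no quadratic part.\<close>

definition sesq_forms :: "(complex option \<Rightarrow> complex) set" where
  "sesq_forms = {f. \<exists>\<alpha> \<beta> \<gamma> \<delta>. f = sesq \<alpha> \<beta> \<gamma> \<delta>}"

lemma sesq_formsI:
  assumes "\<And>p. f p = sesq \<alpha> \<beta> \<gamma> \<delta> p"
  shows "f \<in> sesq_forms"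
  using assms by (auto simp: sesq_forms_def fun_eq_iff)

lemma sesq_forms_0: "(\<lambda>_. 0) \<in> sesq_forms"
  by (rule sesq_formsI[of _ 0 0 0 0]) (simp add: sesq_def split: option.split)

lemma sesq_forms_add:
  assumes "f \<in> sesq_forms" "g \<in> sesq_forms"
  shows "(\<lambda>p. f p + g p) \<in> sesq_forms"
proof -
  obtain a b c d where f: "f = sesq a b c d"
    using assms by (auto simp: sesq_forms_def)
  obtain a' b' c' d' where g: "g = sesq a' b' c' d'"
    using assms by (auto simp: sesq_forms_def)
  show ?thesis unfolding f g
    by (rule sesq_formsI[of _ "a + a'" "b + b'" "c + c'" "d + d'"])
      (simp add: sesq_def algebra_simps split: option.split)
qed

lemma sesq_forms_scale:
  assumes "f \<in> sesq_forms"
  shows "(\<lambda>p. k * f p) \<in> sesq_forms"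
proof -
  obtain a b c d where f: "f = sesq a b c d"
    using assms by (auto simp: sesq_forms_def)
  show ?thesis unfolding f
    by (rule sesq_formsI[of _ "k * a" "k * b" "k * c" "k * d"])
      (simp add: sesq_def algebra_simps split: option.split)
qed

lemma sesq_forms_sum:
  assumes "\<And>i. i \<in> A \<Longrightarrow> f i \<in> sesq_forms"
  shows "(\<lambda>p. \<Sum>i\<in>A. f i p) \<in> sesq_forms"
  using assms
  by (induction A rule: infinite_finite_induct) (auto intro: sesq_forms_add sesq_forms_0)

lemma zero_set_Some:
  assumes "f None \<noteq> (0 :: 'b :: zero)" "\<And>z. f (Some z) = 0 \<longleftrightarrow> z \<in> S"
  shows "{p. f p = 0} = Some ` S"
proof (rule Set.set_eqI)
  show "p \<in> {p. f p = 0} \<longleftrightarrow> p \<in> Some ` S" for p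
    using assms by (cases p) auto
qed

lemma zero_set_None:
  assumes "f None = (0 :: 'b :: zero)" "\<And>z. f (Some z) = 0 \<longleftrightarrow> z \<in> S"
  shows "{p. f p = 0} = insert None (Some ` S)"
proof (rule Set.set_eqI)
  show "p \<in> {p. f p = 0} \<longleftrightarrow> p \<in> insert None (Some ` S)" for p
    using assms by (cases p) auto
qed

definition power_form :: "complex \<Rightarrow> real \<Rightarrow> complex option \<Rightarrow> complex" where
  "power_form w \<rho> p = (case p of None \<Rightarrow> 1 | Some z \<Rightarrow> (z - w) * cnj (z - w) - of_real (\<rho>\<^sup>2))"

lemma power_form_sesq: "power_form w \<rho> \<in> sesq_forms"
  by (rule sesq_formsI[of _ 1 "- cnj w" "- w" "w * cnj w - of_real (\<rho>\<^sup>2)"])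
    (simp add: power_form_def sesq_def algebra_simps split: option.split)

lemma zero_set_power_form:
  assumes "\<rho> > 0"
  shows "{p. power_form w \<rho> p = 0} = Some ` sphere w \<rho>"
proof (rule zero_set_Some)
  fix z
  have "power_form w \<rho> (Some z) = (z - w) * cnj (z - w) - of_real (\<rho>\<^sup>2)"
    by (simp add: power_form_def)
  also have "\<dots> = of_real ((norm (z - w))\<^sup>2 - \<rho>\<^sup>2)"
    by (simp only: complex_norm_square of_real_diff)
  also have "\<dots> = 0 \<longleftrightarrow> norm (z - w) = \<rho>"
    using assms by (simp only: of_real_eq_0_iff) simp
  finally show "power_form w \<rho> (Some z) = 0 \<longleftrightarrow> z \<in> sphere w \<rho>"
    by (simp add: dist_norm norm_minus_commute)
qed (simp add: power_form_def)

text \<open>A finite connected set has at most one point, while a sphere has antipodal ones; a line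
  is parametrised injectively by the reals.\<close>

lemma infinite_circle:
  assumes "is_circle C"
  shows "infinite C"
proof -
  from assms consider (s) z r where "r > 0" "C = Some ` sphere z r"
    | (l) a b where "a \<noteq> 0" "C = insert None (Some ` {z. inner a z = b})"
    unfolding is_circle_def by blast
  then show ?thesis
  proof cases
    case s
    have "z + of_real r \<in> sphere z r" "z - of_real r \<in> sphere z r"
      using s by (simp_all add: dist_norm)
    moreover have "z + of_real r \<noteq> z - of_real r"
      using s by (simp add: complex_eq_iff)
    moreover have "connected (sphere z r)"
      by (rule connected_sphere) simp
    ultimately have "infinite (sphere z r)"
      by (metis connected_finite_iff_sing empty_iff singletonD)
    then show ?thesis
      using s by (simp add: finite_image_iff)
  next
    case l
    define h where "h = (\<lambda>t::real. (b / (norm a)\<^sup>2) *\<^sub>R a + t *\<^sub>R (\<i> * a))"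
    have "inj h"
      using l by (auto simp: inj_def h_def)
    moreover have "inner a (\<i> * a) = 0"
      by (simp add: inner_complex_def)
    then have "inner a (h t) = b" for t
      using l by (simp add: h_def inner_add_right dot_square_norm)
    then have "range h \<subseteq> {z. inner a z = b}"
      by auto
    ultimately have "infinite {z. inner a z = b}"
      using finite_subset finite_imageD infinite_UNIV_char_0 by blast
    then show ?thesis
      using l by (simp add: finite_image_iff)
  qed
qed

lemma circle_form:
  assumes "is_circle C"
  shows "\<exists>f\<in>sesq_forms. C = {p. f p = 0}"
proof -
  from assms consider (s) z r where "r > 0" "C = Some ` sphere z r"
    | (l) a b where "a \<noteq> 0" "C = insert None (Some ` {z. inner a z = b})"
    unfolding is_circle_def by blast
  then show ?thesis
  proof cases
    case s
    then show ?thesis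
      using power_form_sesq[of z r] zero_set_power_form[of r z] by auto
  next
    case l
    define f where "f = sesq 0 (cnj a) a (of_real (- 2 * b))"
    have "f (Some w) = 0 \<longleftrightarrow> w \<in> {w. inner a w = b}" for w
    proof -
      have "f (Some w) = of_real (2 * inner a w - 2 * b)"
        by (simp add: f_def complex_eq_iff inner_complex_def algebra_simps)
      then show ?thesis
        by (simp only: of_real_eq_0_iff) auto
    qed
    then have "C = {p. f p = 0}"
      unfolding l(2) by (intro zero_set_None[symmetric]) (auto simp: f_def)
    moreover have "f \<in> sesq_forms"
      by (auto simp: f_def sesq_forms_def)
    ultimately show ?thesis by blast
  qed
qed

text \<open>Dividing the difference of two equations by the difference of the roots leaves
  \<open>A * (x + y) + B = 0\<close>; a second difference isolates \<open>A\<close>. Lines and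
  spheres are both reduced to this.\<close>

lemma quadratic_three_roots:
  fixes A B C x y z :: "'a :: idom"
  assumes "x \<noteq> y" "x \<noteq> z" "y \<noteq> z"
    and "A * (x * x) + B * x + C = 0" "A * (y * y) + B * y + C = 0" "A * (z * z) + B * z + C = 0"
  shows "A = 0" "B = 0" "C = 0"
proof -
  have "(x - y) * (A * (x + y) + B) = A * (x * x) + B * x + C - (A * (y * y) + B * y + C)"
    "(x - z) * (A * (x + z) + B) = A * (x * x) + B * x + C - (A * (z * z) + B * z + C)"
    by (simp_all add: algebra_simps)
  then have "(x - y) * (A * (x + y) + B) = 0" "(x - z) * (A * (x + z) + B) = 0"
    using assms(4-6) by simp_all
  then have 1: "A * (x + y) + B = 0" "A * (x + z) + B = 0"
    using assms by auto
  have "A * (y - z) = A * (x + y) + B - (A * (x + z) + B)"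
    by (simp add: algebra_simps)
  then have "A * (y - z) = 0"
    using 1 by simp
  then show A: "A = 0"
    using assms by auto
  show B: "B = 0"
    using 1 A by auto
  show "C = 0"
    using assms A B by auto
qed

text \<open>Division by \<open>a\<close> makes the line vertical: the real part of
  \<open>z / a\<close> is \<open>inner a z\<close> divided by the squared norm of
  \<open>a\<close>.\<close>

lemma line_param:
  assumes "a \<noteq> 0" "inner a z = b"
  shows "\<exists>t. z = of_real (b / (norm a)\<^sup>2) * a + of_real t * (\<i> * a)"
proof -
  define t where "t = Im (z / a)"
  have n: "norm a \<noteq> 0" "(norm a)\<^sup>2 \<noteq> 0"
    using assms by auto
  have "Re (z / a) = b / (norm a)\<^sup>2"
    using assms(2)
    by (simp add: inner_complex_def Re_divide cmod_power2 algebra_simps)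
  then have "z / a = of_real (b / (norm a)\<^sup>2) + \<i> * of_real t"
    by (simp add: t_def complex_eq_iff)
  then have "z = (of_real (b / (norm a)\<^sup>2) + \<i> * of_real t) * a"
    using assms(1) by (simp add: field_simps)
  then show ?thesis
    by (intro exI[of _ t]) (simp add: algebra_simps)
qed

text \<open>Along the line the form is a quadratic polynomial in the real parameter. A zero at
  infinity removes the leading coefficient and leaves a linear polynomial with two roots. Only
  \<open>p\<close> may be infinite here.\<close>

lemma line_three_zeros:
  assumes f: "f \<in> sesq_forms" and a: "a \<noteq> 0"
    and C: "C = insert None (Some ` {z. inner a z = b})"
    and "p \<in> C" "Some y \<in> C" "Some z \<in> C" "p \<noteq> Some y" "p \<noteq> Some z" "y \<noteq> z"
    and "f p = 0" "f (Some y) = 0" "f (Some z) = 0"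
  shows "C \<subseteq> {p. f p = 0}"
proof -
  obtain \<alpha> \<beta> \<gamma> \<delta> where fd: "f = sesq \<alpha> \<beta> \<gamma> \<delta>"
    using f by (auto simp: sesq_forms_def)
  define e where "e = complex_of_real (b / (norm a)\<^sup>2) * a"
  define g where "g = \<i> * a"
  have g: "g \<noteq> 0"
    using a by (simp add: g_def)
  have par: "\<exists>t. x = e + of_real t * g" if "inner a x = b" for x
    using line_param[OF a that] by (simp add: e_def g_def)
  define A where "A = \<alpha> * (g * cnj g)"
  define B where "B = \<alpha> * (e * cnj g + g * cnj e) + \<beta> * g + \<gamma> * cnj g"
  define D where "D = f (Some e)"
  have eval: "f (Some (e + of_real t * g)) = A * (of_real t * of_real t) + B * of_real t + D" for t
    by (simp add: fd A_def B_def D_def algebra_simps)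
  obtain ty where ty: "y = e + of_real ty * g"
    using par assms by auto
  obtain tz where tz: "z = e + of_real tz * g"
    using par assms by auto
  have tyz: "complex_of_real ty \<noteq> of_real tz"
    using assms ty tz by auto
  have ABD: "A = 0 \<and> B = 0 \<and> D = 0"
  proof (cases p)
    case None
    then have "A = 0"
      using assms by (simp add: fd A_def)
    moreover have "B * of_real ty + D = 0" "B * of_real tz + D = 0"
      using eval[of ty] eval[of tz] assms ty tz \<open>A = 0\<close> by simp_all
    then have "B * of_real ty + D - (B * of_real tz + D) = 0"
      by (simp only: diff_self)
    then have "B * (of_real ty - of_real tz) = 0"
      by (simp add: algebra_simps)
    then have "B = 0"
      using tyz by simp
    ultimately show ?thesis
      using \<open>B * of_real ty + D = 0\<close> by simp
  next
    case (Some x)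
    then obtain tx where tx: "x = e + of_real tx * g"
      using par assms by auto
    have "complex_of_real tx \<noteq> of_real ty" "complex_of_real tx \<noteq> of_real tz"
      using assms tx ty tz Some by auto
    moreover have "A * (of_real tx * of_real tx) + B * of_real tx + D = 0"
      "A * (of_real ty * of_real ty) + B * of_real ty + D = 0"
      "A * (of_real tz * of_real tz) + B * of_real tz + D = 0"
      using eval[of tx] eval[of ty] eval[of tz] assms tx ty tz Some by simp_all
    ultimately show ?thesis
      using quadratic_three_roots tyz by metis
  qed
  then have "\<alpha> = 0"
    using g by (simp add: A_def)
  then have "f None = 0"
    by (simp add: fd)
  moreover have "f (Some x) = 0" if "inner a x = b" for x
    using par[OF that] eval ABD by auto
  ultimately show ?thesis
    by (auto simp: C)
qed

text \<open>For \<open>v = u - w\<close> on the sphere, \<open>v * cnj v\<close> is the constant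
  \<open>R\<close>, so multiplying the form by the nonzero \<open>v\<close> removes all conjugates
  and leaves a quadratic polynomial in \<open>v\<close>.\<close>

lemma sphere_three_zeros:
  assumes f: "f \<in> sesq_forms" and r: "r > 0"
    and "x \<in> sphere w r" "y \<in> sphere w r" "z \<in> sphere w r" "x \<noteq> y" "x \<noteq> z" "y \<noteq> z"
    and "f (Some x) = 0" "f (Some y) = 0" "f (Some z) = 0"
  shows "Some ` sphere w r \<subseteq> {p. f p = 0}"
proof -
  obtain \<alpha> \<beta> \<gamma> \<delta> where fd: "f = sesq \<alpha> \<beta> \<gamma> \<delta>"
    using f by (auto simp: sesq_forms_def)
  define R where "R = complex_of_real (r\<^sup>2)"
  define A where "A = \<alpha> * cnj w + \<beta>"
  define B where "B = \<alpha> * (w * cnj w + R) + \<beta> * w + \<gamma> * cnj w + \<delta>"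
  define D where "D = (\<alpha> * w + \<gamma>) * R"
  have eval: "u \<noteq> w \<and> (u - w) * f (Some u) = A * ((u - w) * (u - w)) + B * (u - w) + D"
    if "u \<in> sphere w r" for u
  proof
    define v where "v = u - w"
    have "norm v = r"
      using that by (simp add: v_def dist_norm norm_minus_commute)
    then have v: "v * cnj v = R"
      by (metis R_def complex_norm_square)
    have u: "u = w + v"
      by (simp add: v_def)
    show "u \<noteq> w"
      using \<open>norm v = r\<close> r by (auto simp: v_def)
    have "(u - w) * f (Some u) =
      v * (\<alpha> * (w * cnj w + w * cnj v + cnj w * v + v * cnj v) + \<beta> * (w + v) + \<gamma> * (cnj w + cnj v) + \<delta>)"
      unfolding fd u by (simp add: algebra_simps)
    also have "\<dots> = A * (v * v) + B * v + D"
      unfolding A_def B_def D_def v[symmetric] by (simp add: algebra_simps)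
    finally show "(u - w) * f (Some u) = A * ((u - w) * (u - w)) + B * (u - w) + D"
      by (simp add: v_def)
  qed
  have "A = 0" "B = 0" "D = 0"
  proof -
    have ne: "x - w \<noteq> y - w" "x - w \<noteq> z - w" "y - w \<noteq> z - w"
      using assms by auto
    have eq: "A * ((x - w) * (x - w)) + B * (x - w) + D = 0"
      "A * ((y - w) * (y - w)) + B * (y - w) + D = 0"
      "A * ((z - w) * (z - w)) + B * (z - w) + D = 0"
      using eval[of x] eval[of y] eval[of z] assms by simp_all
    show "A = 0" "B = 0" "D = 0"
      using quadratic_three_roots[OF ne eq] by auto
  qed
  then have "f (Some u) = 0" if "u \<in> sphere w r" for u
    using eval[OF that] \<open>A = 0\<close> \<open>B = 0\<close> \<open>D = 0\<close> by auto
  then show ?thesis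
    by blast
qed

lemma circle_three_zeros:
  assumes C: "is_circle C" and f: "f \<in> sesq_forms"
    and in_C: "p \<in> C" "q \<in> C" "s \<in> C" and ne: "p \<noteq> q" "p \<noteq> s" "q \<noteq> s"
    and f0: "f p = 0" "f q = 0" "f s = 0"
  shows "C \<subseteq> {p. f p = 0}"
proof -
  from C consider (s) w r where "r > 0" "C = Some ` sphere w r"
    | (l) a b where "a \<noteq> 0" "C = insert None (Some ` {z. inner a z = b})"
    unfolding is_circle_def by blast
  then show ?thesis
  proof cases
    case s
    obtain x y z where "p = Some x" "q = Some y" "s = Some z"
      using in_C s by auto
    then show ?thesis
      using sphere_three_zeros[OF f s(1), of x w y z] in_C ne f0
      unfolding s(2) by blast
  next
    case l
    \<comment> \<open>At most one of the three points is infinite; it is moved to the first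
      slot.\<close>
    note L = line_three_zeros[OF f l]
    show ?thesis
    proof (cases "q = None")
      case True
      then obtain x z where "p = Some x" "s = Some z"
        using ne by (metis not_None_eq)
      then show ?thesis
        using L[of q x z] in_C ne f0 by auto
    next
      case False
      then obtain y where y: "q = Some y"
        by auto
      show ?thesis
      proof (cases "s = None")
        case True
        then obtain x where "p = Some x"
          using ne by (metis not_None_eq)
        then show ?thesis
          using L[of s x y] in_C ne f0 y by auto
      next
        case False
        then obtain z where "s = Some z"
          by auto
        then show ?thesis
          using L[of p y z] in_C ne f0 y by auto
      qed
    qed
  qed
qed

text \<open>The equation of each circle has three zeros on the other, so each circle contains the
  other.\<close>

lemma circle_eqI:
  assumes "is_circle C" "is_circle C'"
    and "{p, q, s} \<subseteq> C" "{p, q, s} \<subseteq> C'" "p \<noteq> q" "p \<noteq> s" "q \<noteq> s"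
  shows "C = C'"
proof -
  obtain f where f: "f \<in> sesq_forms" "C = {p. f p = 0}"
    using circle_form assms by blast
  obtain g where g: "g \<in> sesq_forms" "C' = {p. g p = 0}"
    using circle_form assms by blast
  have "C \<subseteq> {p. g p = 0}"
    using assms g by (intro circle_three_zeros[of C g p q s]) auto
  moreover have "C' \<subseteq> {p. f p = 0}"
    using assms f by (intro circle_three_zeros[of C' f p q s]) auto
  ultimately show ?thesis
    using f g by auto
qed

lemma card_circle_Int_le:
  assumes "is_circle C" "is_circle C'" "C \<noteq> C'"
  shows "finite (C \<inter> C') \<and> card (C \<inter> C') \<le> 2"
proof (rule ccontr)
  assume "\<not> ?thesis"
  then have "infinite (C \<inter> C') \<or> 3 \<le> card (C \<inter> C')"
    by auto
  then obtain T where "T \<subseteq> C \<inter> C'" "card T = 3"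
    by (metis infinite_arbitrarily_large obtain_subset_with_card_n)
  then obtain p q s where "{p, q, s} \<subseteq> C \<inter> C'" "p \<noteq> q" "p \<noteq> s" "q \<noteq> s"
    by (auto simp: card_3_iff)
  then show False
    using circle_eqI[of C C' p q s] assms by auto
qed

text \<open>Two distinct zeros exclude the nonzero constants (which vanish at most at infinity),
  point circles and circles with negative squared radius.\<close>

lemma real_form_circle:
  fixes \<alpha> \<delta> :: real
  assumes f: "f = sesq (of_real \<alpha>) \<beta> (cnj \<beta>) (of_real \<delta>)"
    and "f p = 0" "f q = 0" "p \<noteq> q" and nz: "\<exists>p. f p \<noteq> 0"
  shows "is_circle {p. f p = 0}"
proof (cases "\<alpha> = 0")
  case True
  have b: "\<beta> \<noteq> 0"
  proof
    assume "\<beta> = 0"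
    then have fd: "f p = (case p of None \<Rightarrow> 0 | Some z \<Rightarrow> of_real \<delta>)" for p
      using True by (simp add: f split: option.split)
    obtain w where "f w \<noteq> 0"
      using nz ..
    then have "\<delta> \<noteq> 0"
      using fd[of w] by (cases w) simp_all
    then show False
      using fd[of p] fd[of q] assms(2-4) by (cases p; cases q) simp_all
  qed
  have "f (Some z) = of_real (2 * inner (cnj \<beta>) z + \<delta>)" for z
    using True by (simp add: f complex_eq_iff inner_complex_def)
  then have "f (Some z) = 0 \<longleftrightarrow> z \<in> {z. inner (cnj \<beta>) z = - \<delta> / 2}" for z
    by (simp only: of_real_eq_0_iff) auto
  then have "{p. f p = 0} = insert None (Some ` {z. inner (cnj \<beta>) z = - \<delta> / 2})"
    using True by (intro zero_set_None) (auto simp: f)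
  then show ?thesis
    unfolding is_circle_def
    using b by (intro disjI2 exI[of _ "cnj \<beta>"] exI[of _ "- \<delta> / 2"] conjI) auto
next
  case False
  \<comment> \<open>Completing the square gives the centre \<open>c\<close> and the squared radius
    \<open>\<rho>\<close>.\<close>
  define c where "c = - cnj \<beta> / of_real \<alpha>"
  define \<rho> where "\<rho> = (norm c)\<^sup>2 - \<delta> / \<alpha>"
  have "f (Some z) = of_real (\<alpha> * ((norm (z - c))\<^sup>2 - \<rho>))" for z
  proof -
    have "\<alpha> * ((norm (z - c))\<^sup>2 - \<rho>) = \<alpha> * ((norm (z - c))\<^sup>2 - (norm c)\<^sup>2) + \<delta>"
      using False by (simp add: \<rho>_def field_simps)
    then have "of_real (\<alpha> * ((norm (z - c))\<^sup>2 - \<rho>)) =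
      of_real \<alpha> * ((z - c) * cnj (z - c) - c * cnj c) + complex_of_real \<delta>"
      by (simp only: complex_norm_square[symmetric] of_real_add of_real_mult of_real_diff of_real_power)
    also have "\<dots> = of_real \<alpha> * (z * cnj z) - of_real \<alpha> * cnj c * z - of_real \<alpha> * c * cnj z + of_real \<delta>"
      by (simp add: algebra_simps)
    also have "\<dots> = f (Some z)"
      using False by (simp add: f c_def)
    finally show ?thesis by simp
  qed
  then have fS: "f (Some z) = 0 \<longleftrightarrow> (norm (z - c))\<^sup>2 = \<rho>" for z
    using False by (simp only: of_real_eq_0_iff) auto
  have fN: "f None \<noteq> 0"
    using False by (simp add: f)
  obtain x y where xy: "p = Some x" "q = Some y" "x \<noteq> y"
    using assms(2-4) fN by (cases p; cases q) auto
  have "\<rho> > 0"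
  proof -
    have "(norm (x - c))\<^sup>2 = \<rho>" "(norm (y - c))\<^sup>2 = \<rho>"
      using fS[of x] fS[of y] assms(2,3) xy by simp_all
    moreover have "norm (x - c) > 0 \<or> norm (y - c) > 0"
      using xy by auto
    then have "(norm (x - c))\<^sup>2 > 0 \<or> (norm (y - c))\<^sup>2 > 0"
      by auto
    ultimately show ?thesis
      by argo
  qed
  have "(norm (z - c))\<^sup>2 = \<rho> \<longleftrightarrow> z \<in> sphere c (sqrt \<rho>)" for z
  proof -
    have "(norm (z - c))\<^sup>2 = \<rho> \<longleftrightarrow> (norm (z - c))\<^sup>2 = (sqrt \<rho>)\<^sup>2"
      using \<open>\<rho> > 0\<close> by simp
    also have "\<dots> \<longleftrightarrow> norm (z - c) = sqrt \<rho>"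
      using \<open>\<rho> > 0\<close> by (intro power2_eq_iff_nonneg) auto
    finally show ?thesis
      by (simp add: dist_norm norm_minus_commute)
  qed
  then have "{p. f p = 0} = Some ` sphere c (sqrt \<rho>)"
    using fS by (intro zero_set_Some fN) (rule trans)
  moreover have "sqrt \<rho> > 0"
    using \<open>\<rho> > 0\<close> by simp
  ultimately show ?thesis
    unfolding is_circle_def by (intro disjI1 exI conjI)
qed

text \<open>The form need not be Hermitian: its zero set is the intersection of those of its Hermitian
  and anti-Hermitian parts.\<close>

lemma zero_set_circle:
  assumes f: "f \<in> sesq_forms"
    and f0: "f p = 0" "f q = 0" "f s = 0" and ne: "p \<noteq> q" "p \<noteq> s" "q \<noteq> s"
    and nz: "{p. f p = 0} \<noteq> UNIV"
  shows "is_circle {p. f p = 0}"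
proof -
  obtain \<alpha> \<beta> \<gamma> \<delta> where fd: "f = sesq \<alpha> \<beta> \<gamma> \<delta>"
    using f by (auto simp: sesq_forms_def)
  define g where "g = sesq (of_real (Re \<alpha>)) ((\<beta> + cnj \<gamma>) / 2) (cnj ((\<beta> + cnj \<gamma>) / 2)) (of_real (Re \<delta>))"
  define h where "h = sesq (of_real (Im \<alpha>)) ((\<beta> - cnj \<gamma>) / (2 * \<i>)) (cnj ((\<beta> - cnj \<gamma>) / (2 * \<i>))) (of_real (Im \<delta>))"
  have g: "g x = of_real (Re (f x))" and h: "h x = of_real (Im (f x))" for x
    by (cases x; simp add: fd g_def h_def complex_eq_iff field_simps)+
  have split: "f x = 0 \<longleftrightarrow> g x = 0 \<and> h x = 0" for x
    by (simp add: g h complex_eq_iff)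
  have G: "is_circle {x. g x = 0}" if "\<exists>x. g x \<noteq> 0"
    using real_form_circle[OF g_def _ _ ne(1) that] f0 split by auto
  have H: "is_circle {x. h x = 0}" if "\<exists>x. h x \<noteq> 0"
    using real_form_circle[OF h_def _ _ ne(1) that] f0 split by auto
  show ?thesis
  proof (cases "\<exists>x. g x \<noteq> 0")
    case True
    show ?thesis
    proof (cases "\<exists>x. h x \<noteq> 0")
      case hT: True
      \<comment> \<open>Both parts define circles through the three given zeros; two zeros would
        allow the circles to be different.\<close>
      have "{x. g x = 0} = {x. h x = 0}"
        using circle_eqI[OF G[OF True] H[OF hT], of p q s] ne f0 split by auto
      then have "{x. f x = 0} = {x. g x = 0}"
        using split by auto
      then show ?thesis
        using G True by auto
    next
      case False
      then show ?thesis
        using G True split by auto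
    qed
  next
    case False
    then have "\<exists>x. h x \<noteq> 0"
      using nz split by auto
    then show ?thesis
      using H False split by auto
  qed
qed

section \<open>Linear dependence of rows and columns\<close>

text \<open>Stated for sets of indices of any two sizes: overlapping windows can be compared without
  enumerating them, and rectangular windows, which describe the points, are treated like square
  ones.\<close>

definition coldep :: "('r \<Rightarrow> 'c \<Rightarrow> 'a :: field) \<Rightarrow> 'r set \<Rightarrow> 'c set \<Rightarrow> bool" where
  "coldep M R C \<longleftrightarrow> (\<exists>x. (\<exists>c\<in>C. x c \<noteq> 0) \<and> (\<forall>r\<in>R. (\<Sum>c\<in>C. M r c * x c) = 0))"

abbreviation rowdep :: "('r \<Rightarrow> 'c \<Rightarrow> 'a :: field) \<Rightarrow> 'r set \<Rightarrow> 'c set \<Rightarrow> bool" where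
  "rowdep M R C \<equiv> coldep (\<lambda>c r. M r c) C R"

lemma coldepI:
  assumes "\<And>r. r \<in> R \<Longrightarrow> (\<Sum>c\<in>C. M r c * x c) = 0" "c \<in> C" "x c \<noteq> 0"
  shows "coldep M R C"
  using assms unfolding coldep_def by blast

text \<open>A relation survives the deletion of equations and extends by zero to further
  columns.\<close>

lemma coldep_mono:
  assumes "coldep M R C" "R' \<subseteq> R" "C \<subseteq> C'" "finite C'"
  shows "coldep M R' C'"
proof -
  obtain x c where x: "\<And>r. r \<in> R \<Longrightarrow> (\<Sum>c\<in>C. M r c * x c) = 0" "c \<in> C" "x c \<noteq> 0"
    using assms(1) unfolding coldep_def by blast
  define x' where "x' = (\<lambda>c. if c \<in> C then x c else 0)"
  have "(\<Sum>c\<in>C'. M r c * x' c) = (\<Sum>c\<in>C. M r c * x c)" for r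
    using assms(3,4) by (intro sum.mono_neutral_cong_right) (auto simp: x'_def)
  then show ?thesis
    using x assms by (intro coldepI[where x = x' and c = c]) (auto simp: x'_def)
qed

text \<open>Gaussian elimination, by induction on the number of equations: a nonzero entry of the
  new row serves as pivot.\<close>

lemma coldep_underdetermined:
  fixes M :: "'r \<Rightarrow> 'c \<Rightarrow> 'a :: field"
  assumes "finite R" "finite C" "card R < card C"
  shows "coldep M R C"
  using assms
proof (induction R arbitrary: C M rule: finite_induct)
  case empty
  then obtain c where "c \<in> C"
    by fastforce
  then show ?case
    by (intro coldepI[where x = "\<lambda>_. 1"]) auto
next
  case (insert r R)
  show ?case
  proof (cases "\<exists>c\<in>C. M r c \<noteq> 0")
    case False
    have "coldep M R C"
      using insert by simp
    then obtain x c where x: "\<And>r. r \<in> R \<Longrightarrow> (\<Sum>c\<in>C. M r c * x c) = 0" "c \<in> C" "x c \<noteq> 0"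
      unfolding coldep_def by blast
    have "(\<Sum>c\<in>C. M r c * x c) = 0"
      using False by (intro sum.neutral) auto
    then show ?thesis
      using x by (intro coldepI[where x = x and c = c]) blast+
  next
    case True
    then obtain d where d: "d \<in> C" "M r d \<noteq> 0"
      by blast
    \<comment> \<open>The remaining rows after elimination of column \<open>d\<close> by means of
      row \<open>r\<close>.\<close>
    define N where "N = (\<lambda>s c. M s c - M s d * M r c / M r d)"
    have "coldep N R (C - {d})"
      using insert d by (intro insert.IH) auto
    then obtain x c where x: "\<And>s. s \<in> R \<Longrightarrow> (\<Sum>c\<in>C-{d}. N s c * x c) = 0"
      "c \<in> C - {d}" "x c \<noteq> 0"
      unfolding coldep_def by blast
    \<comment> \<open>Back substitution: the coefficient of \<open>d\<close> in \<open>x'\<close> is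
      chosen so that row \<open>r\<close> is satisfied, which turns a relation for \<open>N\<close>
      into one for \<open>M\<close>.\<close>
    define S where "S = (\<lambda>s. \<Sum>c\<in>C-{d}. M s c * x c)"
    define x' where "x' = x(d := - S r / M r d)"
    have sum: "(\<Sum>c\<in>C. M s c * x' c) = S s - M s d * S r / M r d" for s
    proof -
      have "(\<Sum>c\<in>C. M s c * x' c) = M s d * x' d + (\<Sum>c\<in>C-{d}. M s c * x' c)"
        using insert d by (simp add: sum.remove)
      also have "(\<Sum>c\<in>C-{d}. M s c * x' c) = S s"
        unfolding S_def by (intro sum.cong) (auto simp: x'_def)
      finally show ?thesis
        by (simp add: x'_def)
    qed
    have N: "(\<Sum>c\<in>C-{d}. N s c * x c) = S s - M s d * S r / M r d" for s
    proof -
      define k where "k = M s d / M r d"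
      have "(\<Sum>c\<in>C-{d}. N s c * x c) = (\<Sum>c\<in>C-{d}. M s c * x c - k * (M r c * x c))"
        by (intro sum.cong) (simp_all add: N_def k_def algebra_simps)
      also have "\<dots> = S s - k * S r"
        by (simp add: S_def sum_subtractf sum_distrib_left)
      finally show ?thesis
        by (simp add: k_def)
    qed
    show ?thesis
    proof (rule coldepI[where x = x' and c = c])
      fix s assume "s \<in> insert r R"
      then consider "s = r" | "s \<in> R"
        by blast
      then show "(\<Sum>c\<in>C. M s c * x' c) = 0"
      proof cases
        case 1
        then show ?thesis
          unfolding sum[of s] using d(2) by simp
      next
        case 2
        then show ?thesis
          unfolding sum[of s] N[of s, symmetric] by (rule x(1))
      qed
    qed (use x in \<open>auto simp: x'_def\<close>)
  qed
qed

text \<open>After deletion of a column \<open>d\<close> with \<open>x d \<noteq> 0\<close> there are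
  more rows than columns, hence a row relation \<open>y\<close>. Evaluating the double sum of
  \<open>M\<close> against \<open>x\<close> and \<open>y\<close> in both orders shows that
  \<open>y\<close> also annihilates column \<open>d\<close>.\<close>

lemma coldep_imp_rowdep:
  fixes M :: "'r \<Rightarrow> 'c \<Rightarrow> 'a :: field"
  assumes "finite R" "finite C" "card R = card C" "coldep M R C"
  shows "rowdep M R C"
proof -
  obtain x d where x: "\<And>r. r \<in> R \<Longrightarrow> (\<Sum>c\<in>C. M r c * x c) = 0" "d \<in> C" "x d \<noteq> 0"
    using assms unfolding coldep_def by blast
  have "card (C - {d}) < card R"
    using assms x by (metis card_Diff1_less)
  then have "coldep (\<lambda>c r. M r c) (C - {d}) R"
    using assms by (intro coldep_underdetermined) auto
  then obtain y q where y: "\<And>c. c \<in> C - {d} \<Longrightarrow> (\<Sum>r\<in>R. M r c * y r) = 0" "q \<in> R" "y q \<noteq> 0"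
    unfolding coldep_def by blast
  have "x d * (\<Sum>r\<in>R. M r d * y r) = (\<Sum>c\<in>C. x c * (\<Sum>r\<in>R. M r c * y r))"
    using y(1) x(2) assms(2) by (simp add: sum.remove[of C d])
  also have "\<dots> = (\<Sum>r\<in>R. y r * (\<Sum>c\<in>C. M r c * x c))"
    by (simp add: sum_distrib_left mult_ac) (rule sum.swap)
  also have "\<dots> = 0"
    using x by simp
  finally have "(\<Sum>r\<in>R. M r d * y r) = 0"
    using x by simp
  then show ?thesis
    using y by (intro coldepI[where x = y and c = q]) (metis DiffI singletonD)+
qed

lemma coldep_iff_rowdep:
  assumes "finite R" "finite C" "card R = card C"
  shows "coldep M R C \<longleftrightarrow> rowdep M R C"
  using coldep_imp_rowdep[of R C M] coldep_imp_rowdep[of C R "\<lambda>c r. M r c"] assms by auto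

text \<open>If the rows in \<open>R\<close> are independent, then both further rows lie in their span.\<close>

lemma rowdep_insert_insert:
  fixes M :: "'r \<Rightarrow> 'c \<Rightarrow> 'a :: field"
  assumes fin: "finite R" "finite C" and card: "card C = Suc (card R)"
    and notin: "r1 \<notin> R" "r2 \<notin> R"
    and dep: "rowdep M (insert r1 R) C" "rowdep M (insert r2 R) C"
  shows "rowdep M R C \<or> coldep M (insert r1 (insert r2 R)) C"
proof (rule disjCI)
  assume nd: "\<not> coldep M (insert r1 (insert r2 R)) C"
  \<comment> \<open>Pairing a row relation \<open>y\<close> on \<open>insert q R\<close> with
    \<open>x\<close> leaves only the term of \<open>q\<close>. As row \<open>q\<close> does not
    annihilate \<open>x\<close>, its coefficient is zero and the relation already lives on
    \<open>R\<close>.\<close>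
  have span: "rowdep M R C"
    if q: "q \<notin> R" and dep: "rowdep M (insert q R) C"
      and x: "\<And>r. r \<in> R \<Longrightarrow> (\<Sum>c\<in>C. M r c * x c) = 0"
      and nz: "(\<Sum>c\<in>C. M q c * x c) \<noteq> 0" for q x
  proof -
    obtain y p where y: "\<And>c. c \<in> C \<Longrightarrow> (\<Sum>r\<in>insert q R. M r c * y r) = 0"
      "p \<in> insert q R" "y p \<noteq> 0"
      using dep unfolding coldep_def by blast
    have "y q * (\<Sum>c\<in>C. M q c * x c) = (\<Sum>r\<in>insert q R. y r * (\<Sum>c\<in>C. M r c * x c))"
      using x q fin by simp
    also have "\<dots> = (\<Sum>c\<in>C. x c * (\<Sum>r\<in>insert q R. M r c * y r))"
      unfolding sum_distrib_left by (subst sum.swap) (simp add: mult_ac)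
    also have "\<dots> = 0"
      using y by simp
    finally have "y q = 0"
      using nz by simp
    then show ?thesis
      using y q fin by (intro coldepI[where x = y and c = p]) auto
  qed
  have "coldep M R C"
    using fin card by (intro coldep_underdetermined) auto
  then obtain x c where x: "\<And>r. r \<in> R \<Longrightarrow> (\<Sum>c\<in>C. M r c * x c) = 0" "c \<in> C" "x c \<noteq> 0"
    unfolding coldep_def by blast
  have "(\<Sum>c\<in>C. M r1 c * x c) \<noteq> 0 \<or> (\<Sum>c\<in>C. M r2 c * x c) \<noteq> 0"
  proof (rule ccontr)
    assume "\<not> ?thesis"
    then have "coldep M (insert r1 (insert r2 R)) C"
      using x by (intro coldepI[where x = x and c = c]) auto
    then show False
      using nd by blast
  qed
  then show "rowdep M R C"
    using span[of r1 x] span[of r2 x] notin dep x by blast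
qed

text \<open>The zero set version of the Desnanot--Jacobi identity.\<close>

lemma coldep_condensation:
  fixes M :: "'r \<Rightarrow> 'c \<Rightarrow> 'a :: field"
  assumes fin: "finite C" and c: "c1 \<notin> C" "c2 \<notin> C" "c1 \<noteq> c2"
    and full: "coldep M (insert r R) (insert c1 (insert c2 C))"
    and part: "coldep M R (insert c1 C)"
  shows "coldep M (insert r R) (insert c1 C) \<or> coldep M R (insert c2 C)"
proof (rule disjCI)
  assume nd: "\<not> coldep M R (insert c2 C)"
  let ?E = "insert c1 (insert c2 C)"
  obtain w p where w: "\<And>s. s \<in> insert r R \<Longrightarrow> (\<Sum>c\<in>?E. M s c * w c) = 0"
    "p \<in> ?E" "w p \<noteq> 0"
    using full unfolding coldep_def by blast
  obtain x q where x: "\<And>s. s \<in> R \<Longrightarrow> (\<Sum>c\<in>insert c1 C. M s c * x c) = 0"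
    "q \<in> insert c1 C" "x q \<noteq> 0"
    using part unfolding coldep_def by blast
  define y where "y = x(c2 := 0)"
  have y0: "y c2 = 0" and yq: "y q \<noteq> 0" "q \<in> ?E"
    using x c by (auto simp: y_def)
  have "(\<Sum>c\<in>insert c1 C. M s c * y c) = (\<Sum>c\<in>insert c1 C. M s c * x c)" for s
    using c by (intro sum.cong) (auto simp: y_def)
  then have y: "(\<Sum>c\<in>?E. M s c * y c) = 0" if "s \<in> R" for s
    using x(1)[OF that] fin c y0 by simp
  \<comment> \<open>By independence of the columns \<open>insert c2 C\<close> on \<open>R\<close>, a
    relation on \<open>R\<close> is determined by its coefficient at \<open>c1\<close>.\<close>
  have no_c1: "\<forall>c\<in>?E. u c = 0"
    if u: "\<And>s. s \<in> R \<Longrightarrow> (\<Sum>c\<in>?E. M s c * u c) = 0" "u c1 = 0" for u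
  proof (rule ballI, rule ccontr)
    fix c assume "c \<in> ?E" "u c \<noteq> 0"
    then have "c \<in> insert c2 C"
      using u(2) by auto
    moreover have "(\<Sum>c\<in>insert c2 C. M s c * u c) = 0" if "s \<in> R" for s
    proof -
      have "(\<Sum>c\<in>?E. M s c * u c) = (\<Sum>c\<in>insert c2 C. M s c * u c)"
        using fin u(2) by (intro sum.mono_neutral_right) auto
      then show ?thesis
        using u(1)[OF that] by (simp only:)
    qed
    ultimately have "coldep M R (insert c2 C)"
      using \<open>u c \<noteq> 0\<close> by (intro coldepI[where x = u and c = c])
    then show False
      using nd by blast
  qed
  have wc1: "w c1 \<noteq> 0"
  proof
    assume "w c1 = 0"
    then have "\<forall>c\<in>?E. w c = 0"
      by (intro no_c1 w(1)) auto
    then show False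
      using w(2,3) by blast
  qed
  \<comment> \<open>The combination of the two relations that cancels the coefficient at
    \<open>c1\<close>. It vanishes, so \<open>y\<close> is a nonzero multiple of \<open>w\<close>;
    since \<open>y c2 = 0\<close>, also \<open>w c2 = 0\<close>, and \<open>w\<close> is a relation
    without \<open>c2\<close>.\<close>
  define z where "z = (\<lambda>c. y c - y c1 / w c1 * w c)"
  have "(\<Sum>c\<in>?E. M s c * z c) = 0" if "s \<in> R" for s
  proof -
    have "(\<Sum>c\<in>?E. M s c * z c) = (\<Sum>c\<in>?E. M s c * y c) - y c1 / w c1 * (\<Sum>c\<in>?E. M s c * w c)"
      unfolding sum_distrib_left sum_subtractf[symmetric]
      by (intro sum.cong) (auto simp: z_def algebra_simps)
    then show ?thesis
      using y[OF that] w(1)[of s] that by simp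
  qed
  moreover have "z c1 = 0"
    using wc1 by (simp add: z_def)
  ultimately have "\<forall>c\<in>?E. z c = 0"
    by (intro no_c1)
  then have z0: "z q = 0" "z c2 = 0"
    using yq(2) by blast+
  have "y c1 \<noteq> 0"
    using z0(1) yq(1) unfolding z_def by auto
  then have "w c2 = 0"
    using z0(2) y0 wc1 unfolding z_def by simp
  have "p \<in> insert c1 C"
    using w(2,3) \<open>w c2 = 0\<close> by blast
  moreover have "(\<Sum>c\<in>insert c1 C. M s c * w c) = 0" if "s \<in> insert r R" for s
  proof -
    have "(\<Sum>c\<in>?E. M s c * w c) = (\<Sum>c\<in>insert c1 C. M s c * w c)"
      using fin \<open>w c2 = 0\<close> by (intro sum.mono_neutral_right) auto
    then show ?thesis
      using w(1)[OF that] by (simp only:)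
  qed
  ultimately show "coldep M (insert r R) (insert c1 C)"
    using w(3) by (intro coldepI[where x = w and c = p])
qed

lemma coldep_1_1: "coldep M {r} {c} \<longleftrightarrow> M r c = 0"
  by (auto simp: coldep_def intro: exI[of _ "\<lambda>_. 1"])

lemma coldep_2_1:
  "coldep M {r, r'} {c} \<longleftrightarrow> M r c = 0 \<and> M r' c = 0"
  by (auto simp: coldep_def intro: exI[of _ "\<lambda>_. 1"])

lemma coldep_2_2:
  fixes M :: "'r \<Rightarrow> 'c \<Rightarrow> 'a :: field"
  assumes "c \<noteq> c'"
  shows "coldep M {r, r'} {c, c'} \<longleftrightarrow> M r c * M r' c' = M r c' * M r' c"
proof -
  define A B C D where "A = M r c" and "B = M r c'" and "C = M r' c" and "D = M r' c'"
  note ABCD = A_def[symmetric] B_def[symmetric] C_def[symmetric] D_def[symmetric]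
  have sum2: "(\<Sum>d\<in>{c, c'}. M s d * x d) = M s c * x c + M s c' * x c'" for s x
    using assms by simp
  have "coldep M {r, r'} {c, c'} \<longleftrightarrow> (\<exists>y z. (y \<noteq> 0 \<or> z \<noteq> 0) \<and> A * y + B * z = 0 \<and> C * y + D * z = 0)"
  proof
    assume "\<exists>y z. (y \<noteq> 0 \<or> z \<noteq> 0) \<and> A * y + B * z = 0 \<and> C * y + D * z = 0"
    then obtain y z where yz: "y \<noteq> 0 \<or> z \<noteq> 0" "A * y + B * z = 0" "C * y + D * z = 0"
      by blast
    define x where "x d = (if d = c then y else z)" for d
    have "x c = y" "x c' = z"
      using assms by (auto simp: x_def)
    then show "coldep M {r, r'} {c, c'}"
      unfolding coldep_def sum2 using yz by (intro exI[of _ x]) (simp add: ABCD)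
  next
    assume "coldep M {r, r'} {c, c'}"
    then obtain x where x: "\<exists>d\<in>{c, c'}. x d \<noteq> 0"
      "\<forall>s\<in>{r, r'}. M s c * x c + M s c' * x c' = 0"
      unfolding coldep_def sum2 by blast
    then have "A * x c + B * x c' = 0" "C * x c + D * x c' = 0" "x c \<noteq> 0 \<or> x c' \<noteq> 0"
      unfolding A_def B_def C_def D_def by blast+
    then show "\<exists>y z. (y \<noteq> 0 \<or> z \<noteq> 0) \<and> A * y + B * z = 0 \<and> C * y + D * z = 0"
      by blast
  qed
  also have "\<dots> \<longleftrightarrow> A * D = B * C"
  proof
    assume "\<exists>y z. (y \<noteq> 0 \<or> z \<noteq> 0) \<and> A * y + B * z = 0 \<and> C * y + D * z = 0"
    then obtain y z where yz: "y \<noteq> 0 \<or> z \<noteq> 0" "A * y + B * z = 0" "C * y + D * z = 0"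
      by blast
    have "y * (A * D - B * C) = D * (A * y + B * z) - B * (C * y + D * z)"
      "z * (A * D - B * C) = A * (C * y + D * z) - C * (A * y + B * z)"
      by (simp_all add: algebra_simps)
    then show "A * D = B * C"
      using yz by auto
  next
    assume eq: "A * D = B * C"
    show "\<exists>y z. (y \<noteq> 0 \<or> z \<noteq> 0) \<and> A * y + B * z = 0 \<and> C * y + D * z = 0"
    proof (cases "A = 0 \<and> B = 0")
      case True
      show ?thesis
      proof (cases "C = 0 \<and> D = 0")
        case CD: True
        show ?thesis
          using True CD by (intro exI[of _ 1]) simp
      next
        case False
        then show ?thesis
          using True by - (rule exI[of _ "- D"], rule exI[of _ C], auto simp: mult.commute)
      qed
    next
      case False
      then show ?thesis
        using eq by - (rule exI[of _ "- B"], rule exI[of _ A], auto simp: mult.commute)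
    qed
  qed
  finally show ?thesis
    by (simp add: ABCD)
qed

text \<open>For periodic data: a row may be exchanged for an equal one that carries another
  index.\<close>

lemma coldep_insert_cong:
  assumes "\<And>c. c \<in> C \<Longrightarrow> M r c = M r' c"
  shows "coldep M (insert r R) C \<longleftrightarrow> coldep M (insert r' R) C"
proof -
  have "(\<Sum>c\<in>C. M r c * x c) = (\<Sum>c\<in>C. M r' c * x c)" for x
    using assms by (intro sum.cong) auto
  then show ?thesis
    unfolding coldep_def ball_simps(7) by simp
qed

text \<open>The bridge to determinants, which serve only to show that the loci are zero sets of
  forms. Repeating a row merely repeats an equation, while the columns must be enumerated without
  repetition.\<close>

lemma coldep_iff_det:
  fixes M :: "'r \<Rightarrow> 'c \<Rightarrow> 'a :: field"
  assumes ec: "inj_on ec {0..<n}"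
  shows "coldep M (er ` {0..<n}) (ec ` {0..<n}) \<longleftrightarrow> det (mat n n (\<lambda>(i, j). M (er i) (ec j))) = 0"
    (is "_ \<longleftrightarrow> det ?A = 0")
proof -
  have sum: "(\<Sum>c\<in>ec ` {0..<n}. M r c * x c) = (\<Sum>j\<in>{0..<n}. M r (ec j) * x (ec j))" for r x
    using sum.reindex[OF ec] by simp
  have mv: "?A *\<^sub>v v = 0\<^sub>v n \<longleftrightarrow> (\<forall>i<n. (\<Sum>j\<in>{0..<n}. M (er i) (ec j) * vec_index v j) = 0)"
    if "v \<in> carrier_vec n" for v
    using that by (auto simp: Matrix.vec_eq_iff scalar_prod_def)
  have "det ?A = 0 \<longleftrightarrow> (\<exists>v. v \<in> carrier_vec n \<and> v \<noteq> 0\<^sub>v n \<and> ?A *\<^sub>v v = 0\<^sub>v n)"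
    by (rule det_0_iff_vec_prod_zero) simp
  also have "\<dots> \<longleftrightarrow> coldep M (er ` {0..<n}) (ec ` {0..<n})"
  proof
    assume "\<exists>v. v \<in> carrier_vec n \<and> v \<noteq> 0\<^sub>v n \<and> ?A *\<^sub>v v = 0\<^sub>v n"
    then obtain v where v: "v \<in> carrier_vec n" "v \<noteq> 0\<^sub>v n" "?A *\<^sub>v v = 0\<^sub>v n"
      by blast
    then obtain k where k: "k < n" "vec_index v k \<noteq> 0"
      by (auto simp: Matrix.vec_eq_iff)
    define x where "x = (\<lambda>c. vec_index v (the_inv_into {0..<n} ec c))"
    have x: "x (ec j) = vec_index v j" if "j < n" for j
      using that ec by (simp add: x_def the_inv_into_f_f)
    show "coldep M (er ` {0..<n}) (ec ` {0..<n})"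
    proof (rule coldepI[where x = x and c = "ec k"])
      fix r assume "r \<in> er ` {0..<n}"
      then show "(\<Sum>c\<in>ec ` {0..<n}. M r c * x c) = 0"
        using v mv[OF v(1)] by (auto simp: sum x)
    qed (use k x in auto)
  next
    assume "coldep M (er ` {0..<n}) (ec ` {0..<n})"
    then obtain x k where x: "\<And>i. i < n \<Longrightarrow> (\<Sum>c\<in>ec ` {0..<n}. M (er i) c * x c) = 0"
      "k < n" "x (ec k) \<noteq> 0"
      unfolding coldep_def by force
    have "vec n (\<lambda>j. x (ec j)) \<noteq> 0\<^sub>v n"
      using x by (auto simp: Matrix.vec_eq_iff)
    moreover have "?A *\<^sub>v vec n (\<lambda>j. x (ec j)) = 0\<^sub>v n"
      using x by (subst mv) (auto simp: sum)
    ultimately show "\<exists>v. v \<in> carrier_vec n \<and> v \<noteq> 0\<^sub>v n \<and> ?A *\<^sub>v v = 0\<^sub>v n"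
      by (intro exI[of _ "vec n (\<lambda>j. x (ec j))"]) auto
  qed
  finally show ?thesis ..
qed

section \<open>Bordered matrices\<close>

definition lin_form :: "complex \<Rightarrow> complex option \<Rightarrow> complex" where
  "lin_form b p = (case p of None \<Rightarrow> 1 | Some z \<Rightarrow> z - b)"

lemma lin_form_sesq: "(\<lambda>p. lin_form b p * cnj (lin_form c p)) \<in> sesq_forms"
  by (rule sesq_formsI[of _ 1 "- cnj c" "- b" "b * cnj c"])
    (simp add: lin_form_def sesq_def algebra_simps split: option.split)

text \<open>\<open>K\<close> is bordered by the homogeneous coordinates of \<open>p\<close> relative to the points \<open>a u\<close>, \<open>a v\<close> and by
  the equation of the circle with centre \<open>w\<close> and radius \<open>\<rho>\<close> (at infinity, by their leading
  coefficients); the index \<^const>\<open>None\<close> denotes the border.  For a single row and column the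
  determinant is a member of the pencil of circles through \<open>a u\<close> and \<open>a v\<close>; for none it is the
  equation of the circle itself.\<close>

fun bordered ::
    "complex \<Rightarrow> real \<Rightarrow> (int \<Rightarrow> complex) \<Rightarrow> (int \<Rightarrow> int \<Rightarrow> complex) \<Rightarrow> complex option \<Rightarrow>
     int option \<Rightarrow> int option \<Rightarrow> complex" where
  "bordered w \<rho> a K p None None = power_form w \<rho> p"
| "bordered w \<rho> a K p (Some u) None = lin_form (a u) p"
| "bordered w \<rho> a K p None (Some v) = cnj (lin_form (a v) p)"
| "bordered w \<rho> a K p (Some u) (Some v) = K u v"

text \<open>A window of \<open>n\<close> integers centred at \<open>c\<close>. The spacing is 2
  because only odd rows and even columns of \<open>K\<close> come from faces of the pattern.\<close>

definition steps :: "int \<Rightarrow> nat \<Rightarrow> int set" where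
  "steps c n = (\<lambda>k. c - int n + 1 + 2 * int k) ` {0..<n}"

text \<open>The border index belongs to every window, so order \<open>n\<close> means a matrix of
  size \<open>n + 1\<close>, and order 0 leaves the corner entry alone.\<close>

definition border :: "int set \<Rightarrow> int option set" where
  "border S = insert None (Some ` S)"

lemma finite_steps [simp]: "finite (steps c n)"
  by (simp add: steps_def)

lemma card_steps [simp]: "card (steps c n) = n"
  by (simp add: steps_def card_image inj_on_def)

lemma finite_border [simp]: "finite S \<Longrightarrow> finite (border S)"
  by (simp add: border_def)

lemma card_border [simp]: "finite S \<Longrightarrow> card (border S) = Suc (card S)"
  by (auto simp: border_def card_image)

lemma border_mono: "S \<subseteq> S' \<Longrightarrow> border S \<subseteq> border S'"
  by (auto simp: border_def)

lemma border_insert: "border (insert u S) = insert (Some u) (border S)"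
  by (auto simp: border_def)

lemma Some_in_border [simp]: "Some u \<in> border S \<longleftrightarrow> u \<in> S"
  by (auto simp: border_def)

lemma steps_0 [simp]: "steps c 0 = {}"
  by (simp add: steps_def)

lemma in_steps: "x \<in> steps c n \<longleftrightarrow> c - int n < x \<and> x < c + int n \<and> odd (x - c + int n)"
proof
  assume "c - int n < x \<and> x < c + int n \<and> odd (x - c + int n)"
  moreover from this obtain l where "x - c + int n = 2 * l + 1"
    by (blast elim: oddE)
  ultimately have l: "x - c + int n = 2 * l + 1" "c - int n < x" "x < c + int n"
    by blast+
  have "nat l \<in> {0..<n}" "x = c - int n + 1 + 2 * int (nat l)"
    using l by auto
  then show "x \<in> steps c n"
    unfolding steps_def by blast
qed (auto simp: steps_def)

lemma steps_Suc_left: "steps c (Suc n) = insert (c - int n) (steps (c + 1) n)"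
  by (rule Set.set_eqI) (simp add: in_steps, presburger)

lemma steps_Suc_right: "steps c (Suc n) = insert (c + int n) (steps (c - 1) n)"
  by (rule Set.set_eqI) (simp add: in_steps, presburger)

text \<open>Each term of the Leibniz expansion contains either the corner entry or one entry from each
  border.\<close>

lemma det_bordered_sesq:
  assumes er: "\<And>i. i < n \<Longrightarrow> er i \<noteq> None" "er n = None"
    and ec: "\<And>i. i < n \<Longrightarrow> ec i \<noteq> None" "ec n = None"
  shows "(\<lambda>p. det (mat (Suc n) (Suc n) (\<lambda>(i, j). bordered w \<rho> a K p (er i) (ec j)))) \<in> sesq_forms"
proof -
  let ?B = "\<lambda>p i j. bordered w \<rho> a K p (er i) (ec j)"
  have "(\<lambda>p. \<Sum>\<pi> | \<pi> permutes {0..<Suc n}. signof \<pi> * (\<Prod>i = 0..<Suc n. ?B p i (\<pi> i))) \<in> sesq_forms"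
  proof (rule sesq_forms_sum)
    fix \<pi> assume "\<pi> \<in> {\<pi>. \<pi> permutes {0..<Suc n}}"
    then have \<pi>: "\<pi> permutes {0..<Suc n}"
      by simp
    have inj: "\<pi> i = \<pi> j \<longleftrightarrow> i = j" for i j
      using permutes_inj[OF \<pi>] by (auto dest: injD)
    have lt: "\<pi> i < Suc n \<longleftrightarrow> i < Suc n" for i
      using permutes_in_image[OF \<pi>, of i] by auto
    have inner: "\<exists>k. \<forall>p. ?B p i j = k" if "i < n" "j < n" for i j
      using er(1)[OF that(1)] ec(1)[OF that(2)] by auto
    have pr: "\<exists>k. \<forall>p. (\<Prod>i\<in>A. ?B p i (\<pi> i)) = k" if "\<And>i. i \<in> A \<Longrightarrow> i < n \<and> \<pi> i < n" for A
    proof -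
      have "(\<Prod>i\<in>A. ?B p i (\<pi> i)) = (\<Prod>i\<in>A. ?B q i (\<pi> i))" for p q
        by (intro prod.cong refl) (metis inner that)
      then show ?thesis
        by blast
    qed
    have "(\<lambda>p. \<Prod>i = 0..<Suc n. ?B p i (\<pi> i)) \<in> sesq_forms"
    proof (cases "\<pi> n = n")
      case True
      have "\<pi> i < n" if "i < n" for i
        using that lt[of i] inj[of i n] True by (simp add: less_Suc_eq)
      then obtain k where k: "\<And>p. (\<Prod>i\<in>{0..<n}. ?B p i (\<pi> i)) = k"
        using pr[of "{0..<n}"] by auto
      have "(\<Prod>i = 0..<Suc n. ?B p i (\<pi> i)) = k * power_form w \<rho> p" for p
        using k True er ec by simp
      then show ?thesis
        using sesq_forms_scale[OF power_form_sesq] by simp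
    next
      case False
      obtain j where j: "\<pi> j = n"
        using permutes_surj[OF \<pi>] by (metis surjD)
      have jn: "j < n"
        using lt[of j] j False by (metis less_Suc_eq lessI)
      have \<pi>n: "\<pi> n < n"
        using lt[of n] False by (simp add: less_Suc_eq)
      have "\<pi> i < n" if "i \<in> {0..<n} - {j}" for i
        using that lt[of i] inj[of i j] j by (simp add: less_Suc_eq)
      then obtain k where k: "\<And>p. (\<Prod>i\<in>{0..<n} - {j}. ?B p i (\<pi> i)) = k"
        using pr[of "{0..<n} - {j}"] by auto
      obtain u where u: "er j = Some u"
        using er(1)[OF jn] by auto
      obtain v where v: "ec (\<pi> n) = Some v"
        using ec(1)[OF \<pi>n] by auto
      have "(\<Prod>i = 0..<Suc n. ?B p i (\<pi> i)) = k * (lin_form (a u) p * cnj (lin_form (a v) p))" for p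
      proof -
        have "(\<Prod>i = 0..<n. ?B p i (\<pi> i)) = ?B p j (\<pi> j) * k"
          using jn k by (subst prod.remove[of _ j]) auto
        then show ?thesis
          using j u v er ec by simp
      qed
      then show ?thesis
        using sesq_forms_scale[OF lin_form_sesq] by simp
    qed
    then show "(\<lambda>p. signof \<pi> * (\<Prod>i = 0..<Suc n. ?B p i (\<pi> i))) \<in> sesq_forms"
      by (rule sesq_forms_scale)
  qed
  moreover have "det (mat (Suc n) (Suc n) (\<lambda>(i, j). ?B p i j)) =
      (\<Sum>\<pi> | \<pi> permutes {0..<Suc n}. signof \<pi> * (\<Prod>i = 0..<Suc n. ?B p i (\<pi> i)))" for p
  proof -
    have "det (mat (Suc n) (Suc n) (\<lambda>(i, j). ?B p i j)) =
      (\<Sum>\<pi> | \<pi> permutes {0..<Suc n}. signof \<pi> *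
        (\<Prod>i = 0..<Suc n. mat (Suc n) (Suc n) (\<lambda>(i, j). ?B p i j) $$ (i, \<pi> i)))"
      by (rule det_def') simp
    also have "\<dots> = (\<Sum>\<pi> | \<pi> permutes {0..<Suc n}. signof \<pi> * (\<Prod>i = 0..<Suc n. ?B p i (\<pi> i)))"
    proof (intro sum.cong refl arg_cong2[of _ _ _ _ "(*)"] prod.cong)
      fix \<pi> i assume "\<pi> \<in> {\<pi>. \<pi> permutes {0..<Suc n}}" "i \<in> {0..<Suc n}"
      then have "i < Suc n" "\<pi> i < Suc n"
        using permutes_in_image[of \<pi> "{0..<Suc n}" i] by auto
      then show "mat (Suc n) (Suc n) (\<lambda>(i, j). ?B p i j) $$ (i, \<pi> i) = ?B p i (\<pi> i)"
        by simp
    qed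
    finally show ?thesis .
  qed
  ultimately show ?thesis
    by simp
qed

lemma border_steps_enum:
  fixes s :: int and n :: nat
  defines "e \<equiv> \<lambda>i. if i < n then Some (s - int n + 1 + 2 * int i) else None"
  shows "border (steps s n) = e ` {0..<Suc n}" "inj_on e {0..<Suc n}"
proof -
  have "e ` {0..<n} = Some ` steps s n"
    by (auto simp: e_def steps_def image_iff)
  moreover have "e n = None"
    by (simp add: e_def)
  ultimately show "border (steps s n) = e ` {0..<Suc n}"
    by (simp add: border_def atLeast0_lessThan_Suc)
  show "inj_on e {0..<Suc n}"
    by (auto simp: inj_on_def e_def less_Suc_eq split: if_splits)
qed

text \<open>A point \<open>p\<close> of \<open>C\<close> off the sphere determines
  \<open>\<kappa>\<close>. The resulting form vanishes at \<open>\<alpha>\<close>,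
  \<open>\<beta>\<close> and \<open>p\<close>, but not at a third point of the sphere, where the
  power is zero and the product is not. Its zero set is thus a circle sharing three points with
  \<open>C\<close>.\<close>

lemma pencil_member:
  assumes C: "is_circle C" "C \<noteq> Some ` sphere w \<rho>" and \<rho>: "\<rho> > 0"
    and \<alpha>: "Some \<alpha> \<in> C" "\<alpha> \<in> sphere w \<rho>" and \<beta>: "Some \<beta> \<in> C" "\<beta> \<in> sphere w \<rho>"
    and ne: "\<alpha> \<noteq> \<beta>"
  shows "\<exists>\<kappa>. C = {p. \<kappa> * power_form w \<rho> p = lin_form \<alpha> p * cnj (lin_form \<beta> p)}"
proof -
  let ?S = "Some ` sphere w \<rho>"
  have S: "is_circle ?S"
    using \<rho> by (auto simp: is_circle_def)
  have mem_S: "power_form w \<rho> p = 0 \<longleftrightarrow> p \<in> ?S" for p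
    using zero_set_power_form[OF \<rho>, of w] by blast
  have pencil_0: "lin_form \<alpha> p * cnj (lin_form \<beta> p) = 0 \<longleftrightarrow> p = Some \<alpha> \<or> p = Some \<beta>" for p
    by (cases p) (auto simp: lin_form_def)
  have "\<exists>p\<in>C. p \<notin> ?S"
  proof (rule ccontr)
    assume "\<not> ?thesis"
    then have "C \<inter> ?S = C"
      by blast
    then show False
      using card_circle_Int_le[OF C(1) S C(2)] infinite_circle[OF C(1)] by simp
  qed
  then obtain p where p: "p \<in> C" "p \<notin> ?S"
    by blast
  define \<kappa> where "\<kappa> = lin_form \<alpha> p * cnj (lin_form \<beta> p) / power_form w \<rho> p"
  define f where "f = (\<lambda>p. \<kappa> * power_form w \<rho> p + (-1) * (lin_form \<alpha> p * cnj (lin_form \<beta> p)))"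
  have f: "f \<in> sesq_forms"
    unfolding f_def by (intro sesq_forms_add sesq_forms_scale power_form_sesq lin_form_sesq)
  have zeros: "f (Some \<alpha>) = 0" "f (Some \<beta>) = 0" "f p = 0"
  proof -
    have "power_form w \<rho> (Some \<alpha>) = 0" "power_form w \<rho> (Some \<beta>) = 0"
      unfolding mem_S using \<alpha> \<beta> by blast+
    moreover have "lin_form \<alpha> (Some \<alpha>) * cnj (lin_form \<beta> (Some \<alpha>)) = 0"
      "lin_form \<alpha> (Some \<beta>) * cnj (lin_form \<beta> (Some \<beta>)) = 0"
      unfolding pencil_0 by blast+
    ultimately show "f (Some \<alpha>) = 0" "f (Some \<beta>) = 0"
      by (simp_all add: f_def)
    show "f p = 0"
      using p mem_S[of p] by (simp add: f_def \<kappa>_def)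
  qed
  have "\<exists>q\<in>?S. q \<notin> {Some \<alpha>, Some \<beta>}"
    using infinite_circle[OF S] finite_subset[of ?S "{Some \<alpha>, Some \<beta>}"] by blast
  then obtain q where "q \<in> ?S" "q \<notin> {Some \<alpha>, Some \<beta>}"
    by blast
  then have "f q \<noteq> 0"
    using mem_S[of q] pencil_0[of q] by (simp add: f_def)
  then have "{p. f p = 0} \<noteq> UNIV"
    by blast
  have ps: "Some \<alpha> \<noteq> Some \<beta>" "Some \<alpha> \<noteq> p" "Some \<beta> \<noteq> p"
    using ne p \<alpha> \<beta> by auto
  have "is_circle {p. f p = 0}"
    by (rule zero_set_circle[OF f zeros ps]) fact
  then have "C = {p. f p = 0}"
    by (rule circle_eqI[OF C(1) _ _ _ ps]) (use zeros \<alpha>(1) \<beta>(1) p(1) in auto)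
  then show ?thesis
    by (auto simp: f_def)
qed

lemma steps_mono: "steps c n \<subseteq> steps (c + 1) (Suc n)" "steps c n \<subseteq> steps (c - 1) (Suc n)"
  using steps_Suc_right[of "c + 1" n] steps_Suc_left[of "c - 1" n] by auto

lemma steps_mono_Suc: "steps (c + 1) n \<subseteq> steps c (Suc n)" "steps (c - 1) n \<subseteq> steps c (Suc n)"
  using steps_Suc_right[of c n] steps_Suc_left[of c n] by auto

lemma steps_Suc_Suc:
  "steps c (Suc (Suc n)) = insert (c - 1 - int n) (insert (c + 1 + int n) (steps c n))"
  using steps_Suc_right[of c "Suc n"] steps_Suc_left[of "c - 1" n] by (auto simp: algebra_simps)

section \<open>Loci of degenerate bordered windows and their intersections\<close>

locale bordered_system =
  fixes w :: complex and \<rho> :: real and a :: "int \<Rightarrow> complex" and K :: "int \<Rightarrow> int \<Rightarrow> complex"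
begin

abbreviation H :: "complex option \<Rightarrow> int option \<Rightarrow> int option \<Rightarrow> complex" where
  "H \<equiv> bordered w \<rho> a K"

definition minor_zeros :: "nat \<Rightarrow> int \<Rightarrow> int \<Rightarrow> complex option set" where
  "minor_zeros n s t = {p. coldep (H p) (border (steps s n)) (border (steps t n))}"

definition tall_dep :: "nat \<Rightarrow> int \<Rightarrow> int \<Rightarrow> complex option \<Rightarrow> bool" where
  "tall_dep k s t p \<longleftrightarrow> coldep (H p) (border (steps s (Suc k))) (border (steps t k))"

definition wide_dep :: "nat \<Rightarrow> int \<Rightarrow> int \<Rightarrow> complex option \<Rightarrow> bool" where
  "wide_dep k s t p \<longleftrightarrow> rowdep (H p) (border (steps s k)) (border (steps t (Suc k)))"

lemma minor_zeros_rowdep: "p \<in> minor_zeros n s t \<longleftrightarrow> rowdep (H p) (border (steps s n)) (border (steps t n))"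
  unfolding minor_zeros_def mem_Collect_eq by (rule coldep_iff_rowdep) simp_all

lemma minor_zeros_form: "\<exists>f\<in>sesq_forms. minor_zeros n s t = {p. f p = 0}"
proof -
  define e where "e = (\<lambda>c i. if i < n then Some (c - int n + 1 + 2 * int i) else None)"
  define D where "D = (\<lambda>p. det (mat (Suc n) (Suc n) (\<lambda>(i, j). H p (e s i) (e t j))))"
  have enum: "border (steps c n) = e c ` {0..<Suc n}" "inj_on (e c) {0..<Suc n}" for c
    unfolding e_def by (rule border_steps_enum)+
  have "D \<in> sesq_forms"
    unfolding D_def by (rule det_bordered_sesq) (simp_all add: e_def)
  moreover have "p \<in> minor_zeros n s t \<longleftrightarrow> D p = 0" for p
    unfolding minor_zeros_def mem_Collect_eq enum(1) D_def by (rule coldep_iff_det[OF enum(2)])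
  ultimately show ?thesis
    by (intro bexI[of _ D]) auto
qed

text \<open>Adding a column on either side gives windows of order \<open>k + 1\<close>, deleting an
  end row gives windows of order \<open>k\<close>. These four loci are the circles of the four faces
  around a vertex.\<close>

lemma tall_dep_imp:
  assumes "tall_dep k s t p"
  shows "p \<in> minor_zeros (Suc k) s (t + 1)" "p \<in> minor_zeros (Suc k) s (t - 1)"
    and "p \<in> minor_zeros k (s + 1) t" "p \<in> minor_zeros k (s - 1) t"
  unfolding minor_zeros_def mem_Collect_eq
  by (rule coldep_mono[OF assms[unfolded tall_dep_def]];
      simp add: border_mono steps_mono steps_mono_Suc)+

lemma wide_dep_imp:
  assumes "wide_dep k s t p"
  shows "p \<in> minor_zeros (Suc k) (s + 1) t" "p \<in> minor_zeros (Suc k) (s - 1) t"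
    and "p \<in> minor_zeros k s (t + 1)" "p \<in> minor_zeros k s (t - 1)"
  unfolding minor_zeros_rowdep
  by (rule coldep_mono[OF assms[unfolded wide_dep_def]];
      simp add: border_mono steps_mono steps_mono_Suc)+

lemma steps_outer:
  "border (steps (c - 1) (Suc k)) = insert (Some (c - 1 - int k)) (border (steps c k))"
  "border (steps (c + 1) (Suc k)) = insert (Some (c + 1 + int k)) (border (steps c k))"
  "border (steps c (Suc (Suc k))) =
     insert (Some (c - 1 - int k)) (insert (Some (c + 1 + int k)) (border (steps c k)))"
  using steps_Suc_left[of "c - 1" k] steps_Suc_right[of "c + 1" k] steps_Suc_Suc[of c k]
  by (simp_all only: border_insert diff_add_cancel add_diff_cancel_right')

text \<open>The two windows have the same columns and share all rows but one end row each. In the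
  dynamics the first alternative is the old intersection point, the second the new one.\<close>

lemma meet_rows:
  assumes "p \<in> minor_zeros (Suc k) (s - 1) t" "p \<in> minor_zeros (Suc k) (s + 1) t"
  shows "wide_dep k s t p \<or> tall_dep (Suc k) s t p"
  unfolding wide_dep_def tall_dep_def steps_outer(3)
proof (rule rowdep_insert_insert)
  show "rowdep (H p) (insert (Some (s - 1 - int k)) (border (steps s k))) (border (steps t (Suc k)))"
    "rowdep (H p) (insert (Some (s + 1 + int k)) (border (steps s k))) (border (steps t (Suc k)))"
    using assms unfolding minor_zeros_rowdep steps_outer .
qed (simp_all add: in_steps)

lemma meet_cols:
  assumes "p \<in> minor_zeros (Suc k) s (t - 1)" "p \<in> minor_zeros (Suc k) s (t + 1)"
  shows "tall_dep k s t p \<or> wide_dep (Suc k) s t p"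
  unfolding wide_dep_def tall_dep_def steps_outer(3)
proof (rule rowdep_insert_insert[where M = "\<lambda>c r. H p r c"])
  show "coldep (H p) (border (steps s (Suc k))) (insert (Some (t - 1 - int k)) (border (steps t k)))"
    "coldep (H p) (border (steps s (Suc k))) (insert (Some (t + 1 + int k)) (border (steps t k)))"
    using assms unfolding minor_zeros_def mem_Collect_eq steps_outer .
qed (simp_all add: in_steps)

text \<open>Condensation with the last row \<open>?r\<close> and the two end columns. It serves to
  show that the locus of order \<open>k + 2\<close> is not the whole sphere: otherwise the first
  hypothesis would be free.\<close>

lemma minor_zeros_condensation:
  assumes "p \<in> minor_zeros (Suc (Suc k)) s t" "p \<in> minor_zeros (Suc k) (s - 1) (t - 1)"
  shows "p \<in> minor_zeros (Suc k) (s + 1) (t - 1) \<or> p \<in> minor_zeros (Suc k) (s - 1) (t + 1)"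
proof -
  let ?R = "border (steps (s - 1) (Suc k))" and ?r = "Some (s + int (Suc k))"
  let ?C = "border (steps t k)" and ?c1 = "Some (t - 1 - int k)" and ?c2 = "Some (t + 1 + int k)"
  have R: "insert ?r ?R = border (steps s (Suc (Suc k)))"
    using steps_Suc_right[of s "Suc k"] by (simp add: border_insert)
  have "coldep (H p) (insert ?r ?R) (insert ?c1 ?C) \<or> coldep (H p) ?R (insert ?c2 ?C)"
  proof (rule coldep_condensation)
    show "coldep (H p) (insert ?r ?R) (insert ?c1 (insert ?c2 ?C))"
      using assms(1) unfolding R by (simp add: minor_zeros_def steps_outer(3))
    show "coldep (H p) ?R (insert ?c1 ?C)"
      using assms(2) by (simp add: minor_zeros_def steps_outer(1))
  qed (simp_all add: in_steps)
  then show ?thesis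
  proof
    assume "coldep (H p) (insert ?r ?R) (insert ?c1 ?C)"
    \<comment> \<open>All rows of the large window are present here; dropping its first row leaves
      the window centred at \<open>s + 1\<close>.\<close>
    then have "coldep (H p) (border (steps (s + 1) (Suc k))) (border (steps (t - 1) (Suc k)))"
      unfolding R steps_outer(1)[symmetric]
      by (rule coldep_mono) (simp_all add: border_mono steps_mono_Suc)
    then show ?thesis
      by (simp add: minor_zeros_def)
  next
    assume "coldep (H p) ?R (insert ?c2 ?C)"
    then show ?thesis
      by (simp add: minor_zeros_def steps_outer(2))
  qed
qed

end

section \<open>Miquel dynamics\<close>

text \<open>Since 8 = 2 + 2 + 4, every bound in the count must be attained and no overlap is
  possible.\<close>

lemma card_Un_eq_8:
  assumes "finite A" "finite B" "card A \<le> 2" "card B \<le> 2" "card E \<le> 4"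
    and "card (A \<union> B \<union> E) = 8"
  shows "card A = 2" "card B = 2" "A \<inter> B = {}"
proof -
  have "card (A \<union> B \<union> E) \<le> card (A \<union> B) + card E"
    by (rule card_Un_le)
  moreover have "card A + card B = card (A \<union> B) + card (A \<inter> B)"
    using assms by (intro card_Un_Int)
  ultimately have "card A = 2 \<and> card B = 2 \<and> card (A \<inter> B) = 0"
    using assms by linarith
  then show "card A = 2" "card B = 2" "A \<inter> B = {}"
    using assms by auto
qed

lemma no_common_pencil:
  assumes "is_circle A" "is_circle B" "is_circle C"
    and AB: "A \<inter> B = {p, y}" "p \<noteq> y" and "p \<in> C" "y \<in> C"
    and "u \<in> A \<inter> C" "u \<notin> {p, y}" "v \<in> B \<inter> C" "v \<notin> {p, y}"
  shows False
proof -
  have "A = C"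
    using assms by (intro circle_eqI[of A C p y u]) auto
  moreover have "B = C"
    using assms by (intro circle_eqI[of B C p y v]) auto
  ultimately show False
    using infinite_circle[OF assms(3)] AB by (metis finite.emptyI finite.insertI inf.idem)
qed

section \<open>Intersection points and sixth circles in a single defined step\<close>

locale defined_step =
  fixes k :: nat and P :: circle_array
  assumes circle: "is_circle (circ P i j)"
    and step_defined: "step_defined k P"
    and pt_kept: "pt P i j \<in> kept_meet k P i j"
begin

text \<open>Replaced faces alternate, so every vertex is a corner of one, and the eight-point
  condition reaches every vertex.\<close>

lemma face_cases:
  obtains "replaced k i j" | "replaced k i (j - 1)"
proof -
  have "replaced k i j \<or> replaced k i (j - 1)"
    unfolding replaced_def by presburger
  then show thesis
    using that by blast
qed

lemma kept_circles: "\<exists>A B. kept_meet k P i j = A \<inter> B \<and> is_circle A \<and> is_circle B"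
  unfolding kept_meet_def using circle by auto

lemma kept_finite:
  assumes "finite (kept_meet k P i j)"
  shows "card (kept_meet k P i j) \<le> 2"
  using kept_circles card_circle_Int_le assms infinite_circle by (metis inf.idem)

lemma corner_meets:
  assumes "replaced k i j"
  shows "card (kept_meet k P i j) = 2" "card (kept_meet k P (i + 1) j) = 2"
    "card (kept_meet k P (i + 1) (j + 1)) = 2" "card (kept_meet k P i (j + 1)) = 2"
    "kept_meet k P i j \<inter> kept_meet k P (i + 1) j = {}"
    "kept_meet k P i j \<inter> kept_meet k P i (j + 1) = {}"
    "kept_meet k P (i + 1) j \<inter> kept_meet k P (i + 1) (j + 1) = {}"
    "kept_meet k P i (j + 1) \<inter> kept_meet k P (i + 1) (j + 1) = {}"
    "kept_meet k P (i + 1) j \<inter> kept_meet k P i (j + 1) = {}"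
proof -
  let ?A = "kept_meet k P i j" and ?B = "kept_meet k P (i + 1) j"
  let ?C = "kept_meet k P (i + 1) (j + 1)" and ?D = "kept_meet k P i (j + 1)"
  have 8: "card (?A \<union> ?B \<union> ?C \<union> ?D) = 8"
    using step_defined assms by (auto simp: step_defined_def)
  then have "finite (?A \<union> ?B \<union> ?C \<union> ?D)"
    by (metis card.infinite zero_neq_numeral)
  then have fin: "finite ?A" "finite ?B" "finite ?C" "finite ?D"
    by auto
  note le = fin[THEN kept_finite]
  have le4: "card (X \<union> Y) \<le> 4" if "card X \<le> 2" "card Y \<le> 2" for X Y :: "complex option set"
    using card_Un_le[of X Y] that by linarith
  \<comment> \<open>The same union regrouped, with the pair to be separated in front.\<close>
  have AB: "card (?A \<union> ?B \<union> (?C \<union> ?D)) = 8" and AD: "card (?A \<union> ?D \<union> (?B \<union> ?C)) = 8"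
    and BC: "card (?B \<union> ?C \<union> (?A \<union> ?D)) = 8" and DC: "card (?D \<union> ?C \<union> (?A \<union> ?B)) = 8"
    and BD: "card (?B \<union> ?D \<union> (?A \<union> ?C)) = 8"
    using 8 by (simp_all add: Un_ac)
  show "card ?A = 2" "card ?B = 2" "?A \<inter> ?B = {}"
    using card_Un_eq_8[OF _ _ _ _ _ AB] fin le le4 by simp_all
  show "?A \<inter> ?D = {}"
    using card_Un_eq_8[OF _ _ _ _ _ AD] fin le le4 by simp_all
  show "?B \<inter> ?C = {}"
    using card_Un_eq_8[OF _ _ _ _ _ BC] fin le le4 by simp_all
  show "?D \<inter> ?C = {}" "card ?C = 2" "card ?D = 2"
    using card_Un_eq_8[OF _ _ _ _ _ DC] fin le le4 by simp_all
  show "?B \<inter> ?D = {}"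
    using card_Un_eq_8[OF _ _ _ _ _ BD] fin le le4 by simp_all
qed

lemma card_kept: "card (kept_meet k P i j) = 2"
proof (cases rule: face_cases[of i j])
  case 1
  then show ?thesis
    by (rule corner_meets)
next
  case 2
  then show ?thesis
    using corner_meets(4)[OF 2] by simp
qed

lemma kept_disjoint_right: "kept_meet k P i j \<inter> kept_meet k P (i + 1) j = {}"
proof (cases rule: face_cases[of i j])
  case 1
  then show ?thesis
    by (rule corner_meets)
next
  case 2
  then show ?thesis
    using corner_meets(8)[OF 2] by simp
qed

lemma kept_disjoint_up: "kept_meet k P i j \<inter> kept_meet k P i (j + 1) = {}"
proof (cases "replaced k i j")
  case True
  then show ?thesis
    by (rule corner_meets)
next
  case False
  then have "replaced k (i - 1) j"
    unfolding replaced_def by presburger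
  from corner_meets(7)[OF this] show ?thesis
    by simp
qed

lemma other_point:
  shows kept_eq: "kept_meet k P i j = {pt P i j, other_point k P i j}"
    and pt_neq_other: "pt P i j \<noteq> other_point k P i j"
proof -
  obtain x y where xy: "kept_meet k P i j = {x, y}" "x \<noteq> y"
    using card_kept[of i j] by (meson card_2_iff)
  then have "\<exists>!y. y \<noteq> pt P i j \<and> kept_meet k P i j = {pt P i j, y}"
    using pt_kept[of i j] by (auto simp: doubleton_eq_iff)
  then have "other_point k P i j \<noteq> pt P i j \<and> kept_meet k P i j = {pt P i j, other_point k P i j}"
    unfolding other_point_def by (rule theI')
  then show "kept_meet k P i j = {pt P i j, other_point k P i j}"
    "pt P i j \<noteq> other_point k P i j"
    by auto
qed

lemma other_in_kept: "other_point k P i j \<in> kept_meet k P i j"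
  by (simp add: kept_eq)

lemma other_point_right: "other_point k P (i + 1) j \<notin> kept_meet k P i j"
  using kept_disjoint_right[of i j] other_in_kept[of "i + 1" j] by blast

lemma other_point_up: "other_point k P i (j + 1) \<notin> kept_meet k P i j"
  using kept_disjoint_up[of i j] other_in_kept[of i "j + 1"] by blast

lemma other_point_down: "other_point k P i (j - 1) \<notin> kept_meet k P i j"
  using kept_disjoint_up[of i "j - 1"] other_in_kept[of i "j - 1"] by auto

lemma corner_others_distinct:
  assumes "replaced k i j"
  shows "other_point k P i j \<noteq> other_point k P (i + 1) j"
    "other_point k P i j \<noteq> other_point k P i (j + 1)"
    "other_point k P (i + 1) j \<noteq> other_point k P i (j + 1)"
  using other_point_right[of i j] other_point_up[of i j] other_in_kept[of i j]
    corner_meets(9)[OF assms] other_in_kept[of "i + 1" j] other_in_kept[of i "j + 1"]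
  by auto

lemma sixth_circle_eqI:
  assumes "replaced k i j" "is_circle C"
    and "{other_point k P i j, other_point k P (i + 1) j,
      other_point k P (i + 1) (j + 1), other_point k P i (j + 1)} \<subseteq> C"
  shows "sixth_circle k P i j = C"
  unfolding sixth_circle_def
proof (rule the_equality)
  fix C' assume "is_circle C' \<and> {other_point k P i j, other_point k P (i + 1) j,
      other_point k P (i + 1) (j + 1), other_point k P i (j + 1)} \<subseteq> C'"
  then have C': "is_circle C'" "{other_point k P i j, other_point k P (i + 1) j,
      other_point k P (i + 1) (j + 1), other_point k P i (j + 1)} \<subseteq> C'"
    by blast+
  show "C' = C"
    by (rule circle_eqI[OF C'(1) assms(2) _ _ corner_others_distinct[OF assms(1)]])
      (use C'(2) assms(3) in blast)+
qed (use assms in blast)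

end

section \<open>A step of the dynamics as a step of condensation\<close>

context bordered_system
begin

text \<open>The invariant of the dynamics after \<open>k\<close> steps.\<close>

definition state :: "nat \<Rightarrow> circle_array \<Rightarrow> bool" where
  "state k P \<longleftrightarrow> (\<forall>i j. is_circle (circ P i j) \<and>
     (if odd (int k + i + j)
      then circ P i j = minor_zeros (Suc k) (i - j) (i + j + 1) \<and> (\<forall>p. tall_dep k (i - j) (i + j) p \<longleftrightarrow> p = pt P i j)
      else circ P i j = minor_zeros k (i - j) (i + j + 1) \<and> (\<forall>p. wide_dep k (i - j) (i + j) p \<longleftrightarrow> p = pt P i j)))"

text \<open>These are the faces whose locus has the lower order \<open>k\<close>; step
  \<open>k + 1\<close> raises it to \<open>k + 2\<close>.\<close>

lemma replaced_Suc: "replaced (Suc k) i j \<longleftrightarrow> even (int k + i + j)"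
  by (auto simp: replaced_def)

context
  fixes k :: nat and P :: circle_array
  assumes st: "state k P"
begin

lemma state_circle: "is_circle (circ P i j)"
  using st by (simp add: state_def)

lemma state_odd:
  assumes "odd (int k + i + j)"
  shows "circ P i j = minor_zeros (Suc k) (i - j) (i + j + 1)" "tall_dep k (i - j) (i + j) p \<longleftrightarrow> p = pt P i j"
  using st assms by (simp_all add: state_def)

lemma state_even:
  assumes "even (int k + i + j)"
  shows "circ P i j = minor_zeros k (i - j) (i + j + 1)" "wide_dep k (i - j) (i + j) p \<longleftrightarrow> p = pt P i j"
  using st assms by (simp_all add: state_def)

context
  assumes sd: "step_defined (Suc k) P"
begin

lemma kept_even:
  assumes "even (int k + i + j)"
  shows "kept_meet (Suc k) P i j = circ P (i - 1) j \<inter> circ P i (j - 1)"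
    and "circ P (i - 1) j = minor_zeros (Suc k) (i - j - 1) (i + j)"
    and "circ P i (j - 1) = minor_zeros (Suc k) (i - j + 1) (i + j)"
  using assms state_odd(1)[of "i - 1" j] state_odd(1)[of i "j - 1"]
  by (simp_all add: kept_meet_def replaced_Suc algebra_simps)

lemma kept_odd:
  assumes "odd (int k + i + j)"
  shows "kept_meet (Suc k) P i j = circ P i j \<inter> circ P (i - 1) (j - 1)"
    and "circ P i j = minor_zeros (Suc k) (i - j) (i + j + 1)"
    and "circ P (i - 1) (j - 1) = minor_zeros (Suc k) (i - j) (i + j - 1)"
proof -
  have "\<not> replaced (Suc k) i j" "odd (int k + (i - 1) + (j - 1))"
    using assms unfolding replaced_Suc by presburger+
  then show "kept_meet (Suc k) P i j = circ P i j \<inter> circ P (i - 1) (j - 1)"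
    "circ P i j = minor_zeros (Suc k) (i - j) (i + j + 1)"
    "circ P (i - 1) (j - 1) = minor_zeros (Suc k) (i - j) (i + j - 1)"
    using state_odd(1)[OF assms] state_odd(1)[of "i - 1" "j - 1"]
    by (simp_all add: kept_meet_def)
qed

interpretation defined_step "Suc k" P
proof
  fix i j
  show "is_circle (circ P i j)"
    by (rule state_circle)
  show "step_defined (Suc k) P"
    by (rule sd)
  show "pt P i j \<in> kept_meet (Suc k) P i j"
  proof (cases "even (int k + i + j)")
    case True
    then have "wide_dep k (i - j) (i + j) (pt P i j)"
      by (simp add: state_even)
    from wide_dep_imp[OF this] show ?thesis
      by (simp add: kept_even[OF True])
  next
    case False
    then have "tall_dep k (i - j) (i + j) (pt P i j)"
      by (simp add: state_odd)
    from tall_dep_imp[OF this] show ?thesis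
      by (simp add: kept_odd[OF False])
  qed
qed

text \<open>Of the two alternatives of \<open>meet_rows\<close>, the wide one characterises the old
  point, from which the other intersection point differs.\<close>

lemma other_point_even:
  assumes "even (int k + i + j)"
  shows "tall_dep (Suc k) (i - j) (i + j) (other_point (Suc k) P i j)"
  using meet_rows[of "other_point (Suc k) P i j" k "i - j" "i + j"] other_in_kept[of i j]
    pt_neq_other[of i j] state_even(2)[OF assms] kept_even[OF assms]
  by auto

lemma other_point_odd:
  assumes "odd (int k + i + j)"
  shows "wide_dep (Suc k) (i - j) (i + j) (other_point (Suc k) P i j)"
  using meet_cols[of "other_point (Suc k) P i j" k "i - j" "i + j"] other_in_kept[of i j]
    pt_neq_other[of i j] state_odd(2)[OF assms] kept_odd[OF assms]
  by auto

text \<open>This yields Miquel's theorem: the degenerate windows of the four new corners all extend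
  to the same square window of order \<open>k + 2\<close>.\<close>

lemma corners_in_new:
  assumes "even (int k + i + j)"
  shows "{other_point (Suc k) P i j, other_point (Suc k) P (i + 1) j,
      other_point (Suc k) P (i + 1) (j + 1), other_point (Suc k) P i (j + 1)}
    \<subseteq> minor_zeros (Suc (Suc k)) (i - j) (i + j + 1)"
  using tall_dep_imp(1)[OF other_point_even[of i j]] wide_dep_imp(2)[OF other_point_odd[of "i + 1" j]]
    tall_dep_imp(2)[OF other_point_even[of "i + 1" "j + 1"]] wide_dep_imp(1)[OF other_point_odd[of i "j + 1"]]
    assms
  by (simp add: algebra_simps)

lemma new_circle:
  assumes "even (int k + i + j)"
  shows "is_circle (minor_zeros (Suc (Suc k)) (i - j) (i + j + 1))" (is "is_circle ?G")
proof -
  obtain f where f: "f \<in> sesq_forms" "?G = {p. f p = 0}"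
    using minor_zeros_form by blast
  have "?G \<noteq> UNIV"
  proof
    assume U: "?G = UNIV"
    have odd: "odd (int k + i + (j + 1))"
      using assms by presburger
    have circs: "circ P (i - 1) j = minor_zeros (Suc k) (i - j - 1) (i + j + 1 - 1)"
      "circ P i (j - 1) = minor_zeros (Suc k) (i - j + 1) (i + j + 1 - 1)"
      "circ P i (j + 1) = minor_zeros (Suc k) (i - j - 1) (i + j + 1 + 1)"
      using kept_even(2,3)[OF assms] kept_odd(2)[OF odd] by (simp_all add: algebra_simps)
    \<comment> \<open>If the new locus were everything, condensation would confine this infinite
      circle to two finite intersections.\<close>
    have "circ P (i - 1) j \<subseteq> circ P i (j - 1) \<union> circ P i (j + 1)"
    proof
      fix p assume "p \<in> circ P (i - 1) j"
      then show "p \<in> circ P i (j - 1) \<union> circ P i (j + 1)"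
        using minor_zeros_condensation[of p k "i - j" "i + j + 1"] U unfolding circs by blast
    qed
    then have "circ P (i - 1) j \<subseteq> kept_meet (Suc k) P i j \<union> kept_meet (Suc k) P i (j + 1)"
      using kept_even(1)[OF assms] kept_odd(1)[OF odd] by auto
    moreover have "finite (kept_meet (Suc k) P i j)" for i j
      by (simp add: kept_eq)
    ultimately show False
      using infinite_circle[OF state_circle] finite_subset by blast
  qed
  then show ?thesis
    using corners_in_new[OF assms] corner_others_distinct[of i j] assms f
    by (auto simp: replaced_Suc intro!: zero_set_circle[of f "other_point (Suc k) P i j"
          "other_point (Suc k) P (i + 1) j" "other_point (Suc k) P i (j + 1)"])
qed

lemma sixth_circle_minor_zeros:
  assumes "even (int k + i + j)"
  shows "sixth_circle (Suc k) P i j = minor_zeros (Suc (Suc k)) (i - j) (i + j + 1)"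
  using assms by (intro sixth_circle_eqI new_circle corners_in_new) (simp add: replaced_Suc)

text \<open>Otherwise the new circle would contain both intersection points of two kept circles and,
  from the adjacent corners, one further point of each.\<close>

lemma pt_not_new_even:
  assumes "even (int k + i + j)"
  shows "\<not> tall_dep (Suc k) (i - j) (i + j) (pt P i j)"
proof
  assume "tall_dep (Suc k) (i - j) (i + j) (pt P i j)"
  from tall_dep_imp(1)[OF this] have p: "pt P i j \<in> minor_zeros (Suc (Suc k)) (i - j) (i + j + 1)" .
  note y = corners_in_new[OF assms]
  have odd: "odd (int k + (i + 1) + j)" "odd (int k + i + (j + 1))"
    using assms by presburger+
  show False
  proof (rule no_common_pencil)
    show "circ P (i - 1) j \<inter> circ P i (j - 1) = {pt P i j, other_point (Suc k) P i j}"
      using kept_even(1)[OF assms] kept_eq by simp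
    show "other_point (Suc k) P i (j + 1) \<in> circ P (i - 1) j \<inter> minor_zeros (Suc (Suc k)) (i - j) (i + j + 1)"
      using y other_in_kept[of i "j + 1"] kept_odd(1)[OF odd(2)] by simp
    show "other_point (Suc k) P (i + 1) j \<in> circ P i (j - 1) \<inter> minor_zeros (Suc (Suc k)) (i - j) (i + j + 1)"
      using y other_in_kept[of "i + 1" j] kept_odd(1)[OF odd(1)] by simp
    show "other_point (Suc k) P i (j + 1) \<notin> {pt P i j, other_point (Suc k) P i j}"
      "other_point (Suc k) P (i + 1) j \<notin> {pt P i j, other_point (Suc k) P i j}"
      using other_point_up[of i j] other_point_right[of i j] by (simp_all add: kept_eq)
    show "is_circle (circ P (i - 1) j)" "is_circle (circ P i (j - 1))"
      by (rule state_circle)+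
    show "is_circle (minor_zeros (Suc (Suc k)) (i - j) (i + j + 1))"
      by (rule new_circle[OF assms])
    show "pt P i j \<noteq> other_point (Suc k) P i j"
      by (rule pt_neq_other)
    show "pt P i j \<in> minor_zeros (Suc (Suc k)) (i - j) (i + j + 1)"
      "other_point (Suc k) P i j \<in> minor_zeros (Suc (Suc k)) (i - j) (i + j + 1)"
      using p y by simp_all
  qed
qed

lemma pt_not_new_odd:
  assumes "odd (int k + i + j)"
  shows "\<not> wide_dep (Suc k) (i - j) (i + j) (pt P i j)"
proof
  assume "wide_dep (Suc k) (i - j) (i + j) (pt P i j)"
  from wide_dep_imp(1)[OF this] have p: "pt P i j \<in> minor_zeros (Suc (Suc k)) (i - j + 1) (i + j)" (is "_ \<in> ?G") .
  have even: "even (int k + i + (j - 1))" "even (int k + (i + 1) + j)"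
    using assms by presburger+
  \<comment> \<open>The vertex \<open>(i, j)\<close> is a corner of the replaced face
    \<open>(i, j - 1)\<close>; its new locus, recentred.\<close>
  have G: "minor_zeros (Suc (Suc k)) (i - (j - 1)) (i + (j - 1) + 1) = ?G"
    by (simp add: algebra_simps)
  note y = corners_in_new[OF even(1), unfolded G]
  show False
  proof (rule no_common_pencil)
    show "circ P i j \<inter> circ P (i - 1) (j - 1) = {pt P i j, other_point (Suc k) P i j}"
      using kept_odd(1)[OF assms] kept_eq by simp
    show "other_point (Suc k) P (i + 1) j \<in> circ P i j \<inter> ?G"
      using y other_in_kept[of "i + 1" j] kept_even(1)[OF even(2)] by simp
    show "other_point (Suc k) P i (j - 1) \<in> circ P (i - 1) (j - 1) \<inter> ?G"
      using y other_in_kept[of i "j - 1"] kept_even(1)[OF even(1)] by simp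
    show "other_point (Suc k) P (i + 1) j \<notin> {pt P i j, other_point (Suc k) P i j}"
      "other_point (Suc k) P i (j - 1) \<notin> {pt P i j, other_point (Suc k) P i j}"
      using other_point_right[of i j] other_point_down[of i j] by (simp_all add: kept_eq)
    show "is_circle (circ P i j)" "is_circle (circ P (i - 1) (j - 1))"
      by (rule state_circle)+
    show "is_circle ?G"
      using new_circle[OF even(1)] unfolding G .
    show "pt P i j \<noteq> other_point (Suc k) P i j"
      by (rule pt_neq_other)
    show "pt P i j \<in> ?G" "other_point (Suc k) P i j \<in> ?G"
      using p y by simp_all
  qed
qed

lemma state_step: "state (Suc k) (miquel_step (Suc k) P)"
  unfolding state_def
proof (intro allI conjI)
  fix i j
  let ?Q = "miquel_step (Suc k) P"
  have circ: "circ ?Q i j = (if even (int k + i + j) then minor_zeros (Suc (Suc k)) (i - j) (i + j + 1) else circ P i j)"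
    by (simp add: miquel_step_def replaced_Suc sixth_circle_minor_zeros)
  have pt: "pt ?Q i j = other_point (Suc k) P i j"
    by (simp add: miquel_step_def)
  show "is_circle (circ ?Q i j)"
    using new_circle state_circle by (simp add: circ)
  show "if odd (int (Suc k) + i + j)
    then circ ?Q i j = minor_zeros (Suc (Suc k)) (i - j) (i + j + 1) \<and> (\<forall>p. tall_dep (Suc k) (i - j) (i + j) p \<longleftrightarrow> p = pt ?Q i j)
    else circ ?Q i j = minor_zeros (Suc k) (i - j) (i + j + 1) \<and> (\<forall>p. wide_dep (Suc k) (i - j) (i + j) p \<longleftrightarrow> p = pt ?Q i j)"
  proof (cases "even (int k + i + j)")
    case True
    \<comment> \<open>Deleting end rows puts any solution on both kept circles, so it is the old or
      the new intersection point, and the old one has been excluded.\<close>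
    have "p = other_point (Suc k) P i j" if "tall_dep (Suc k) (i - j) (i + j) p" for p
    proof -
      have "p \<in> kept_meet (Suc k) P i j"
        using tall_dep_imp(3,4)[OF that] kept_even[OF True] by simp
      then show ?thesis
        using pt_not_new_even[OF True] that unfolding kept_eq by blast
    qed
    then have "tall_dep (Suc k) (i - j) (i + j) p \<longleftrightarrow> p = pt ?Q i j" for p
      unfolding pt using other_point_even[OF True] by blast
    moreover have "odd (int (Suc k) + i + j)"
      using True by presburger
    ultimately show ?thesis
      using True by (simp only: circ if_True) simp
  next
    case False
    have "p = other_point (Suc k) P i j" if "wide_dep (Suc k) (i - j) (i + j) p" for p
    proof -
      have "p \<in> kept_meet (Suc k) P i j"
        using wide_dep_imp(3,4)[OF that] kept_odd[OF False] by simp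
      then show ?thesis
        using pt_not_new_odd[OF False] that unfolding kept_eq by blast
    qed
    then have "wide_dep (Suc k) (i - j) (i + j) p \<longleftrightarrow> p = pt ?Q i j" for p
      unfolding pt using other_point_odd[OF False] by blast
    moreover have "\<not> odd (int (Suc k) + i + j)"
      using False by presburger
    ultimately show ?thesis
      using False state_odd(1)[OF False] by (simp only: circ if_False) simp
  qed
qed

end

end

lemma state_iter:
  assumes "state 0 P" "miquel_applicable n P"
  shows "state n (miquel_iter n P)"
  using assms(2)
proof (induction n)
  case (Suc n)
  then have "state n (miquel_iter n P)" "step_defined (Suc n) (miquel_iter n P)"
    by (simp_all add: miquel_applicable_def)
  then show ?case
    using state_step by simp
qed (use assms in simp)

end

section \<open>Periodic initial data\<close>

lemma int_shift_2:
  fixes f :: "int \<Rightarrow> 'b"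
  assumes shift: "\<And>s. even (s - c) \<Longrightarrow> f (s + 2) = f s" and "even (s - c)"
  shows "f s = f c"
proof -
  obtain z where s: "s = c + 2 * z"
    using assms(2) by (metis add.commute diff_add_cancel evenE)
  show ?thesis
    unfolding s
  proof (induction z rule: int_induct[where k = 0])
    case (step1 z)
    then show ?case
      using shift[of "c + 2 * z"] by (simp add: algebra_simps)
  next
    case (step2 z)
    then show ?case
      using shift[of "c + 2 * (z - 1)"] by (simp add: algebra_simps)
  qed simp
qed

context bordered_system
begin

lemma state_circle_pattern:
  assumes st: "state k P"
  shows "circle_pattern P"
  unfolding circle_pattern_def
proof (intro allI conjI)
  fix i j
  show "is_circle (circ P i j)"
    using st by (rule state_circle)
  show "{pt P i j, pt P (i + 1) j, pt P (i + 1) (j + 1), pt P i (j + 1)} \<subseteq> circ P i j"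
  proof (cases "odd (int k + i + j)")
    case True
    have right: "even (int k + (i + 1) + j)" and up: "even (int k + i + (j + 1))"
      and diag: "odd (int k + (i + 1) + (j + 1))"
      using True by presburger+
    have "pt P i j \<in> circ P i j"
      using tall_dep_imp(1)[of k "i - j" "i + j" "pt P i j"] state_odd[OF st True] by simp
    moreover have "pt P (i + 1) j \<in> circ P i j"
      using wide_dep_imp(2)[of k "i + 1 - j" "i + 1 + j" "pt P (i + 1) j"] state_even(2)[OF st right]
        state_odd(1)[OF st True] by (simp add: algebra_simps)
    moreover have "pt P (i + 1) (j + 1) \<in> circ P i j"
      using tall_dep_imp(2)[of k "i + 1 - (j + 1)" "i + 1 + (j + 1)" "pt P (i + 1) (j + 1)"]
        state_odd(2)[OF st diag] state_odd(1)[OF st True] by (simp add: algebra_simps)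
    moreover have "pt P i (j + 1) \<in> circ P i j"
      using wide_dep_imp(1)[of k "i - (j + 1)" "i + (j + 1)" "pt P i (j + 1)"] state_even(2)[OF st up]
        state_odd(1)[OF st True] by (simp add: algebra_simps)
    ultimately show ?thesis
      by simp
  next
    case False
    then have this_even: "even (int k + i + j)" and right: "odd (int k + (i + 1) + j)"
      and up: "odd (int k + i + (j + 1))" and diag: "even (int k + (i + 1) + (j + 1))"
      by presburger+
    have "pt P i j \<in> circ P i j"
      using wide_dep_imp(3)[of k "i - j" "i + j" "pt P i j"] state_even[OF st this_even] by simp
    moreover have "pt P (i + 1) j \<in> circ P i j"
      using tall_dep_imp(4)[of k "i + 1 - j" "i + 1 + j" "pt P (i + 1) j"] state_odd(2)[OF st right]
        state_even(1)[OF st this_even] by (simp add: algebra_simps)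
    moreover have "pt P (i + 1) (j + 1) \<in> circ P i j"
      using wide_dep_imp(4)[of k "i + 1 - (j + 1)" "i + 1 + (j + 1)" "pt P (i + 1) (j + 1)"]
        state_even(2)[OF st diag] state_even(1)[OF st this_even] by (simp add: algebra_simps)
    moreover have "pt P i (j + 1) \<in> circ P i j"
      using tall_dep_imp(3)[of k "i - (j + 1)" "i + (j + 1)" "pt P i (j + 1)"] state_odd(2)[OF st up]
        state_even(1)[OF st this_even] by (simp add: algebra_simps)
    ultimately show ?thesis
      by simp
  qed
qed

lemma minor_zeros_0:
  assumes "\<rho> > 0"
  shows "minor_zeros 0 s t = Some ` sphere w \<rho>"
  using zero_set_power_form[OF assms] by (simp add: minor_zeros_def border_def coldep_1_1)

lemma minor_zeros_1: "minor_zeros (Suc 0) u v = {p. K u v * power_form w \<rho> p = lin_form (a u) p * cnj (lin_form (a v) p)}"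
  by (auto simp: minor_zeros_def border_def steps_def coldep_2_2 mult.commute)

text \<open>The only column is the border: the linear entry singles out \<open>a u\<close>, and the
  power vanishes there because \<open>a u\<close> lies on the circle.\<close>

lemma tall_dep_0:
  assumes "\<rho> > 0" "a u \<in> sphere w \<rho>"
  shows "tall_dep 0 u v p \<longleftrightarrow> p = Some (a u)"
proof -
  have "Some (a u) \<in> {p. power_form w \<rho> p = 0}"
    unfolding zero_set_power_form[OF assms(1)] using assms(2) by blast
  then show ?thesis
    by (cases p) (auto simp: tall_dep_def border_def steps_def coldep_2_1 lin_form_def)
qed

lemma wide_dep_0:
  assumes "\<rho> > 0" "a v \<in> sphere w \<rho>"
  shows "wide_dep 0 u v p \<longleftrightarrow> p = Some (a v)"
proof -
  have "Some (a v) \<in> {p. power_form w \<rho> p = 0}"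
    unfolding zero_set_power_form[OF assms(1)] using assms(2) by blast
  then show ?thesis
    by (cases p) (auto simp: wide_dep_def border_def steps_def coldep_2_1 lin_form_def simp flip: complex_cnj_diff)
qed

text \<open>With \<open>2 * (k + 1)\<close>-periodic data, shifting a window of \<open>k + 1\<close> rows or columns by one step
  replaces one of them by an equal one.\<close>

context
  fixes k :: nat
  assumes a_per: "\<And>u. a (u + 2 * int (Suc k)) = a u"
    and K_row: "\<And>u v. odd u \<Longrightarrow> even v \<Longrightarrow> K (u + 2 * int (Suc k)) v = K u v"
    and K_col: "\<And>u v. odd u \<Longrightarrow> even v \<Longrightarrow> K u (v + 2 * int (Suc k)) = K u v"
begin

lemma steps_shift:
  "steps s (Suc k) = insert (s - int k) (steps (s + 1) k)"
  "steps (s + 2) (Suc k) = insert (s - int k + 2 * int (Suc k)) (steps (s + 1) k)"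
  using steps_Suc_left[of s k] steps_Suc_right[of "s + 2" k] by (simp_all add: algebra_simps)

text \<open>The entering and the leaving row differ by a full period. The parity conditions keep to
  those entries of \<open>K\<close> whose periodicity is known.\<close>

lemma row_shift:
  assumes "odd (s - int k)" "\<And>v. v \<in> S \<Longrightarrow> even v"
  shows "coldep (H p) (border (steps (s + 2) (Suc k))) (border S) \<longleftrightarrow> coldep (H p) (border (steps s (Suc k))) (border S)"
  unfolding steps_shift[of s] border_insert
proof (rule coldep_insert_cong)
  fix c assume "c \<in> border S"
  then show "H p (Some (s - int k + 2 * int (Suc k))) c = H p (Some (s - int k)) c"
    using assms a_per K_row by (cases c) (auto simp del: of_nat_Suc)
qed

lemma col_shift:
  assumes "even (t - int k)" "\<And>u. u \<in> S \<Longrightarrow> odd u"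
  shows "rowdep (H p) (border S) (border (steps (t + 2) (Suc k))) \<longleftrightarrow> rowdep (H p) (border S) (border (steps t (Suc k)))"
  unfolding steps_shift[of t] border_insert
proof (rule coldep_insert_cong)
  fix c assume "c \<in> border S"
  then show "H p c (Some (t - int k + 2 * int (Suc k))) = H p c (Some (t - int k))"
    using assms a_per K_col by (cases c) (auto simp del: of_nat_Suc)
qed

lemma minor_zeros_shift:
  assumes "odd (s - int k)" "even (t - int k)"
  shows "minor_zeros (Suc k) (s + 2) t = minor_zeros (Suc k) s t" "minor_zeros (Suc k) s (t + 2) = minor_zeros (Suc k) s t"
proof -
  have "even v" if "v \<in> steps t (Suc k)" for v
    using that assms(2) unfolding in_steps by presburger
  then show "minor_zeros (Suc k) (s + 2) t = minor_zeros (Suc k) s t"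
    unfolding minor_zeros_def using row_shift[OF assms(1)] by simp
  have "odd u" if "u \<in> steps s (Suc k)" for u
    using that assms(1) unfolding in_steps by presburger
  then show "minor_zeros (Suc k) s (t + 2) = minor_zeros (Suc k) s t"
    using col_shift[OF assms(2)] unfolding set_eq_iff minor_zeros_rowdep by simp
qed

text \<open>Only the \<open>k + 1\<close> rows fill a whole period; the \<open>k\<close> columns do
  not. Hence the condition becomes independent of \<open>s\<close> but keeps its dependence on
  \<open>t\<close>.\<close>

lemma tall_dep_shift:
  assumes "odd (s - int k)" "odd (t - int k)"
  shows "tall_dep k (s + 2) t = tall_dep k s t"
proof -
  have "even v" if "v \<in> steps t k" for v
    using that assms(2) unfolding in_steps by presburger
  then show ?thesis
    unfolding fun_eq_iff tall_dep_def using row_shift[OF assms(1)] by simp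
qed

lemma wide_dep_shift:
  assumes "even (s - int k)" "even (t - int k)"
  shows "wide_dep k s (t + 2) = wide_dep k s t"
proof -
  have "odd u" if "u \<in> steps s k" for u
    using that assms(1) unfolding in_steps by presburger
  then show ?thesis
    unfolding fun_eq_iff wide_dep_def using col_shift[OF assms(2)] by simp
qed

lemma tall_dep_const:
  assumes "odd (s - int k)" "odd (s' - int k)" "odd (t - int k)"
  shows "tall_dep k s t = tall_dep k s' t"
  by (rule int_shift_2[where f = "\<lambda>s. tall_dep k s t"], rule tall_dep_shift) (use assms in presburger)+

lemma wide_dep_const:
  assumes "even (s - int k)" "even (t - int k)" "even (t' - int k)"
  shows "wide_dep k s t = wide_dep k s t'"
  by (rule int_shift_2[where f = "wide_dep k s"], rule wide_dep_shift) (use assms in presburger)+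

lemma minor_zeros_const:
  assumes "odd (s - int k)" "odd (s' - int k)" "even (t - int k)" "even (t' - int k)"
  shows "minor_zeros (Suc k) s t = minor_zeros (Suc k) s' t'"
proof -
  have "minor_zeros (Suc k) s t = minor_zeros (Suc k) s' t"
    by (rule int_shift_2[where f = "\<lambda>s. minor_zeros (Suc k) s t"], rule minor_zeros_shift(1)) (use assms in presburger)+
  also have "\<dots> = minor_zeros (Suc k) s' t'"
    by (rule int_shift_2[where f = "minor_zeros (Suc k) s'"], rule minor_zeros_shift(2)) (use assms in presburger)+
  finally show ?thesis .
qed

text \<open>Equal degeneracy conditions have equal solutions, because \<open>state\<close> makes
  each solution unique. The centre in \<open>D\<close> is one choice with the required
  parities.\<close>

lemma state_periodic_dodgson:
  assumes st: "state k P"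
  defines "D \<equiv> minor_zeros (Suc k) (int k + 1) (int k)"
  shows "is_circle D" "dodgson_pattern (\<lambda>x. odd (int k + x)) D P"
proof -
  have face: "circ P i j = D" if "odd (int k + i + j)" for i j
    unfolding state_odd(1)[OF st that] D_def by (rule minor_zeros_const) (use that in presburger)+
  have "circ P (int k) (- 1) = D"
    by (rule face) presburger
  then show "is_circle D"
    using state_circle[OF st] by metis
  \<comment> \<open>On the row \<open>j = 0\<close> the indices \<open>i + j\<close> and
    \<open>i - j\<close> agree, so one row supplies the values for both parities.\<close>
  define p0 where "p0 = (\<lambda>x. pt P x 0)"
  have "p0 x \<in> D" for x
  proof (cases "odd (int k + x)")
    case True
    then have "tall_dep k x x (p0 x)"
      using state_odd(2)[OF st, of x 0] by (simp add: p0_def)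
    moreover have "minor_zeros (Suc k) x (x + 1) = D"
      unfolding D_def by (rule minor_zeros_const) (use True in presburger)+
    ultimately show ?thesis
      using tall_dep_imp(1) by blast
  next
    case False
    then have "wide_dep k x x (p0 x)"
      using state_even(2)[OF st, of x 0] by (simp add: p0_def)
    moreover have "minor_zeros (Suc k) (x + 1) x = D"
      unfolding D_def by (rule minor_zeros_const) (use False in presburger)+
    ultimately show ?thesis
      using wide_dep_imp(1) by blast
  qed
  moreover have "pt P i j = (if odd (int k + (i + j)) then p0 (i + j) else p0 (i - j))" for i j
  proof (cases "odd (int k + i + j)")
    case True
    then have "tall_dep k (i - j) (i + j) (pt P i j)"
      using state_odd(2)[OF st] by blast
    moreover have "tall_dep k (i - j) (i + j) = tall_dep k (i + j) (i + j)"
      by (rule tall_dep_const) (use True in presburger)+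
    moreover have "odd (int k + (i + j) + 0)"
      using True by presburger
    ultimately show ?thesis
      using state_odd(2)[OF st, of "i + j" 0] by (simp add: p0_def)
  next
    case False
    then have "wide_dep k (i - j) (i + j) (pt P i j)"
      using state_even(2)[OF st] by blast
    moreover have "wide_dep k (i - j) (i + j) = wide_dep k (i - j) (i - j)"
      by (rule wide_dep_const) (use False in presburger)+
    moreover have "even (int k + (i - j) + 0)" "even (int k + (i + j))"
      using False by presburger+
    ultimately show ?thesis
      using state_even(2)[OF st, of "i - j" 0] by (simp add: p0_def)
  qed
  ultimately show "dodgson_pattern (\<lambda>x. odd (int k + x)) D P"
    unfolding dodgson_pattern_def
    using \<open>is_circle D\<close> state_circle_pattern[OF st] face
    by (auto simp: image_subset_iff add.assoc intro!: exI[of _ p0])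
qed

end

end

section \<open>From a closed Dodgson pattern to a periodic bordered system\<close>

theorem theorem3p7:
  fixes m :: nat and D :: "complex option set" and P :: circle_array
  assumes "m \<ge> 1"
    and "is_circle D" and "None \<notin> D"
    and "even_dodgson D P"
    and "doubly_closed m P"
    and "edge_generic P"
    and "miquel_applicable (m - 1) P"
  shows "\<exists>D'. is_circle D' \<and>
    (even m \<longrightarrow> even_dodgson D' (miquel_iter (m - 1) P)) \<and>
    (odd m \<longrightarrow> odd_dodgson D' (miquel_iter (m - 1) P))"
proof -
  obtain k where m: "m = Suc k"
    using assms(1) by (metis Suc_le_D One_nat_def)
  obtain w \<rho> where \<rho>: "\<rho> > 0" and D: "D = Some ` sphere w \<rho>"
    using assms(2,3) unfolding is_circle_def by blast
  have dodgson: "dodgson_pattern even D P"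
    using assms(4) by (simp add: even_dodgson_def)
  then obtain p0 where p0: "range p0 \<subseteq> D"
    and pt: "\<And>i j. pt P i j = (if even (i + j) then p0 (i + j) else p0 (i - j))"
    and even_face: "\<And>i j. even (i + j) \<Longrightarrow> circ P i j = D"
    and pattern: "circle_pattern P"
    unfolding dodgson_pattern_def by blast
  define a where "a u = the (p0 u)" for u
  have a: "a u \<in> sphere w \<rho>" and p0_a: "p0 u = Some (a u)" for u
    using p0 unfolding D a_def by (auto dest!: subsetD[where c = "p0 u"])
  have circle: "is_circle (circ P i j)" for i j
    using pattern by (simp add: circle_pattern_def)
  \<comment> \<open>The odd faces in the coordinates \<open>u = i - j\<close> and
    \<open>v = i + j + 1\<close>; the divisions invert this change of indices.\<close>
  define c where "c u v = circ P ((u + v - 1) div 2) ((v - 1 - u) div 2)" for u v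
  have c_circ: "c (i - j) (i + j + 1) = circ P i j" for i j
  proof -
    have "(i - j + (i + j + 1) - 1) div 2 = i" "(i + j + 1 - 1 - (i - j)) div 2 = j"
      by simp_all
    then show ?thesis
      by (simp only: c_def)
  qed
  have face: "\<exists>i j. odd (i + j) \<and> u = i - j \<and> v = i + j + 1" if "odd u" "even v" for u v :: int
  proof -
    obtain x where x: "u = 2 * x + 1"
      using \<open>odd u\<close> by (rule oddE)
    obtain y where y: "v = 2 * y"
      using \<open>even v\<close> by (rule evenE)
    show ?thesis
      by (intro exI[of _ "x + y"] exI[of _ "y - x - 1"]) (simp add: x y)
  qed
  have c: "is_circle (c u v)" "c u v \<noteq> D" "Some (a u) \<in> c u v" "Some (a v) \<in> c u v" "a u \<noteq> a v"
    if "odd u" "even v" for u v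
  proof -
    obtain i j where ij: "odd (i + j)" "u = i - j" "v = i + j + 1"
      using face \<open>odd u\<close> \<open>even v\<close> by blast
    have cij: "c u v = circ P i j"
      using c_circ ij by simp
    have pij: "pt P i j = Some (a u)" "pt P (i + 1) j = Some (a v)"
    proof -
      have "i + 1 + j = v"
        using ij by simp
      then show "pt P i j = Some (a u)" "pt P (i + 1) j = Some (a v)"
        using ij(1,2) \<open>even v\<close> pt[of i j] pt[of "i + 1" j] p0_a[of u] p0_a[of v] by simp_all
    qed
    show "is_circle (c u v)"
      unfolding cij by (rule circle)
    show "Some (a u) \<in> c u v" "Some (a v) \<in> c u v"
      unfolding cij pij[symmetric] using pattern by (simp_all add: circle_pattern_def)
    \<comment> \<open>The adjacent face is even and hence carries \<open>D\<close>, so genericity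
      across the common edge applies.\<close>
    have "even (i + 1 + j)"
      using ij by simp
    then show "c u v \<noteq> D"
      unfolding cij using assms(6) even_face[of "i + 1" j] unfolding edge_generic_def by metis
    show "a u \<noteq> a v"
      using assms(6) pij unfolding edge_generic_def by metis
  qed
  have c_per: "c (u + 2 * int (Suc k)) v = c u v" "c u (v + 2 * int (Suc k)) = c u v"
    if "odd u" "even v" for u v
  proof -
    obtain i j where ij: "u = i - j" "v = i + j + 1"
      using face \<open>odd u\<close> \<open>even v\<close> by blast
    \<comment> \<open>The translation by \<open>(m, m)\<close> moves \<open>v\<close> alone and the
      one by \<open>(m, -m)\<close> moves \<open>u\<close> alone, each by
      \<open>2 * m\<close>.\<close>
    have eq: "circ P (i + int m) (j + int m) = circ P i j" "circ P (i + int m) (j - int m) = circ P i j"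
      using assms(5) unfolding doubly_closed_def by blast+
    have idx: "i + int m - (j + int m) = i - j" "i + int m + (j + int m) + 1 = i + j + 1 + 2 * int (Suc k)"
      "i + int m - (j - int m) = i - j + 2 * int (Suc k)" "i + int m + (j - int m) + 1 = i + j + 1"
      by (simp_all add: m)
    show "c u (v + 2 * int (Suc k)) = c u v"
      using c_circ[of "i + int m" "j + int m"] unfolding ij idx eq c_circ .
    show "c (u + 2 * int (Suc k)) v = c u v"
      using c_circ[of "i + int m" "j - int m"] unfolding ij idx eq c_circ .
  qed
  have c_D: "x = a u \<or> x = a v" if "odd u" "even v" "Some x \<in> c u v" "x \<in> sphere w \<rho>" for u v x
  proof (rule ccontr)
    assume "\<not> ?thesis"
    then have "c u v = D"
      using that a c(1,3,4,5)[OF that(1,2)] assms(2) unfolding D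
      by (intro circle_eqI[of _ _ "Some x" "Some (a u)" "Some (a v)"]) auto
    then show False
      using c(2)[OF that(1,2)] by blast
  qed
  \<comment> \<open>By closedness the shifted point lies on the same odd circle as
    \<open>a u\<close>. That circle meets \<open>D\<close> only in two points, and genericity
    excludes the other one.\<close>
  have a_per: "a (u + 2 * int (Suc k)) = a u" for u
  proof (cases "even u")
    case True
    then have "Some (a (u + 2 * int (Suc k))) \<in> c 1 u"
      using c(4)[of 1 "u + 2 * int (Suc k)"] c_per(2)[of 1 u] by simp
    moreover have "a 1 \<noteq> a (u + 2 * int (Suc k))"
      using True by (intro c(5)) simp_all
    ultimately show ?thesis
      using c_D[of 1 u] a True by (metis odd_one)
  next
    case False
    then have "Some (a (u + 2 * int (Suc k))) \<in> c u 0"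
      using c(3)[of "u + 2 * int (Suc k)" 0] c_per(1)[of u 0] by simp
    moreover have "a (u + 2 * int (Suc k)) \<noteq> a 0"
      using False by (intro c(5)) simp_all
    ultimately show ?thesis
      using c_D[of u 0] a False by (metis even_zero)
  qed
  \<comment> \<open>The choice depends only on \<open>c u v\<close>, \<open>a u\<close> and
    \<open>a v\<close>, so the periodicity of these data passes to \<open>K\<close> without a
    uniqueness argument.\<close>
  define K where "K u v = (SOME \<kappa>. c u v =
    {p. \<kappa> * power_form w \<rho> p = lin_form (a u) p * cnj (lin_form (a v) p)})" for u v
  have K: "c u v = {p. K u v * power_form w \<rho> p = lin_form (a u) p * cnj (lin_form (a v) p)}"
    if "odd u" "even v" for u v
    unfolding K_def
    by (rule someI_ex, rule pencil_member) (use c[OF that] a \<rho> in \<open>simp_all add: D\<close>)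
  interpret bordered_system w \<rho> a K .
  have "state 0 P"
    unfolding state_def
  proof (intro allI conjI)
    fix i j
    show "is_circle (circ P i j)"
      by (rule circle)
    show "if odd (int 0 + i + j)
      then circ P i j = minor_zeros (Suc 0) (i - j) (i + j + 1) \<and> (\<forall>p. tall_dep 0 (i - j) (i + j) p \<longleftrightarrow> p = pt P i j)
      else circ P i j = minor_zeros 0 (i - j) (i + j + 1) \<and> (\<forall>p. wide_dep 0 (i - j) (i + j) p \<longleftrightarrow> p = pt P i j)"
    proof (cases "odd (i + j)")
      case True
      then have "odd (i - j)" "even (i + j + 1)"
        by presburger+
      then have "circ P i j = minor_zeros (Suc 0) (i - j) (i + j + 1)"
        unfolding minor_zeros_1 c_circ[symmetric] by (rule K)
      then show ?thesis
        using True by (simp add: tall_dep_0[OF \<rho> a] pt p0_a)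
    next
      case False
      then show ?thesis
        using even_face[of i j] by (simp add: minor_zeros_0[OF \<rho>] wide_dep_0[OF \<rho> a] pt p0_a D)
    qed
  qed
  then have st: "state k (miquel_iter k P)"
    using assms(7) by (intro state_iter) (simp_all add: m)
  have K_per: "K (u + 2 * int (Suc k)) v = K u v" "K u (v + 2 * int (Suc k)) = K u v"
    if "odd u" "even v" for u v
    by (simp_all only: K_def c_per[OF that] a_per)
  let ?D = "minor_zeros (Suc k) (int k + 1) (int k)"
  have "is_circle ?D"
    by (rule state_periodic_dodgson(1)[OF a_per K_per st])
  moreover have "dodgson_pattern (\<lambda>x. odd (int k + x)) ?D (miquel_iter k P)"
    by (rule state_periodic_dodgson(2)[OF a_per K_per st])
  \<comment> \<open>Since \<open>k = m - 1\<close>, the parity of \<open>k\<close> is opposite to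
    that of \<open>m\<close>.\<close>
  moreover have "(\<lambda>x. odd (int k + x)) = even" if "even m"
    using that by (auto simp: fun_eq_iff m)
  moreover have "(\<lambda>x. odd (int k + x)) = odd" if "odd m"
    using that by (auto simp: fun_eq_iff m)
  ultimately show ?thesis
    unfolding even_dodgson_def odd_dodgson_def m by (intro exI[of _ ?D]) auto
qed

end
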